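(* Let $(W,S)$ be a Coxeter system with $S$ finite, and let $\Gamma=\Gamma(W,S)$ be its Cayley graph with respect to $S$. The defining diagram of $(W,S)$ is not flexible if and only if the automorphism group $\operatorname{Aut}(\Gamma)$ can be written as a semidirect product $\operatorname{Aut}(\Gamma)=W\rtimes D$, where $W$ (identified with $\{L_w : w\in W\}$) and $D$ are the subgroups of left-multiplication automorphisms and of diagram automorphisms of $\Gamma$, respectively (that is, $\operatorname{Aut}(\Gamma)$ is the internal semidirect product of these subgroups, with the subgroup of left-multiplication automorphisms normal).
   Context: A Coxeter system $(W,S)$ is a group $W$ with generating set $S$ and presentation $\langle S \mid s^2\ (s\in S),\ (st)^{m_{st}}\ (s\neq t\in S,\ m_{st}<\infty)\rangle$, where $m_{st}=m_{ts}\in\{2,3,\dots\}\cup\{\infty\}$ is the order of $st$ for $s \ne t$. The Cayley graph $\Gamma(W,S)$ is the undirected graph with vertex set $W$ and a single edge between $w$ and $ws$, labelled $s$, for each $w\in W$, $s\in S$. $\operatorname{Aut}(\Gamma)$ is the group of graph automorphisms, not required to preserve edge labels. The defining diagram of $(W,S)$ is the labelled graph with vertex set $S$, with an edge between distinct $s,t$ if and only if $m_{st}<\infty$, this edge being labelled $m_{st}$. It is flexible if there are a vertex $s\in S$ and a nontrivial label-preserving automorphism $\phi$ of the defining diagram such that $\phi$ fixes $s$ and fixes every vertex joined to $s$ by an edge of the defining diagram. A left-multiplication automorphism of $\Gamma$ is a map $L_w(x)=wx$ with $w\in W$. An automorphism of the Coxeter diagram is a permutation $\pi$ of $S$ with $m_{\pi(s)\pi(t)}=m_{st}$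 for all distinct $s,t\in S$; a diagram automorphism of $\Gamma$ is the automorphism of $\Gamma$ given on vertices by the group automorphism of $W$ extending such a permutation $\pi$. *)

theory Defs
  imports "HOL-Algebra.Algebra" "HOL-Library.Extended_Nat"
begin

subsection \<open>Group presentations\<close>

text \<open>Words over the generators and their formal inverses: the letter \<open>(s, True)\<close> stands for
  \<open>s\<close> and \<open>(s, False)\<close> for its formal inverse.\<close>

type_synonym 'a word = "('a \<times> bool) list"

definition words :: "'a set \<Rightarrow> 'a word set" where
  "words S = lists (S \<times> UNIV)"

definition eval_letter :: "('a, 'b) monoid_scheme \<Rightarrow> 'a \<times> bool \<Rightarrow> 'a" where
  "eval_letter G l = (if snd l then fst l else inv\<^bsub>G\<^esub> (fst l))"

definition eval_word :: "('a, 'b) monoid_scheme \<Rightarrow> 'a word \<Rightarrow> 'a" where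
  "eval_word G w = foldr (\<lambda>l x. eval_letter G l \<otimes>\<^bsub>G\<^esub> x) w \<one>\<^bsub>G\<^esub>"

inductive elementary_reduction :: "'a set \<Rightarrow> 'a word set \<Rightarrow> 'a word \<Rightarrow> 'a word \<Rightarrow> bool"
  for S :: "'a set" and R :: "'a word set" where
  cancel: "\<lbrakk>u \<in> words S; v \<in> words S; s \<in> S\<rbrakk>
    \<Longrightarrow> elementary_reduction S R (u @ [(s, b), (s, \<not> b)] @ v) (u @ v)"
| relator: "\<lbrakk>u \<in> words S; v \<in> words S; r \<in> R\<rbrakk>
    \<Longrightarrow> elementary_reduction S R (u @ r @ v) (u @ v)"

text \<open>The words equivalent to the empty word under inserting and deleting cancelling pairs and
  relators are those representing an element of the normal closure of \<open>R\<close> in the free group on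
  \<open>S\<close>. The last conjunct thus says that the canonical homomorphism from the free group onto \<open>G\<close>
  has this normal closure as its kernel.\<close>

definition has_presentation :: "('a, 'b) monoid_scheme \<Rightarrow> 'a set \<Rightarrow> 'a word set \<Rightarrow> bool" where
  "has_presentation G S R \<longleftrightarrow>
     S \<subseteq> carrier G \<and> generate G S = carrier G \<and> R \<subseteq> words S \<and>
     (\<forall>w \<in> words S. eval_word G w = \<one>\<^bsub>G\<^esub> \<longleftrightarrow> equivclp (elementary_reduction S R) w [])"

subsection \<open>Coxeter systems\<close>

text \<open>The library function \<open>group.ord\<close> returns 0 on elements of infinite order.\<close>

definition cox_m :: "('a, 'b) monoid_scheme \<Rightarrow> 'a \<Rightarrow> 'a \<Rightarrow> enat" where
  "cox_m W s t =
     (if group.ord W (s \<otimes>\<^bsub>W\<^esub> t) = 0 then \<infinity> else enat (group.ord W (s \<otimes>\<^bsub>W\<^esub> t)))"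

definition coxeter_relators :: "('a, 'b) monoid_scheme \<Rightarrow> 'a set \<Rightarrow> 'a word set" where
  "coxeter_relators W S =
     {[(s, True), (s, True)] | s. s \<in> S} \<union>
     {concat (replicate n [(s, True), (t, True)]) | s t n.
        s \<in> S \<and> t \<in> S \<and> s \<noteq> t \<and> cox_m W s t = enat n}"

definition coxeter_system :: "('a, 'b) monoid_scheme \<Rightarrow> 'a set \<Rightarrow> bool" where
  "coxeter_system W S \<longleftrightarrow> group W \<and> has_presentation W S (coxeter_relators W S)"

subsection \<open>The defining diagram\<close>

definition diagram_edge :: "('a, 'b) monoid_scheme \<Rightarrow> 'a set \<Rightarrow> 'a \<Rightarrow> 'a \<Rightarrow> bool" where
  "diagram_edge W S s t \<longleftrightarrow> s \<in> S \<and> t \<in> S \<and> s \<noteq> t \<and> cox_m W s t < \<infinity>"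

definition defining_diagram_aut ::
  "('a, 'b) monoid_scheme \<Rightarrow> 'a set \<Rightarrow> ('a \<Rightarrow> 'a) \<Rightarrow> bool" where
  "defining_diagram_aut W S \<phi> \<longleftrightarrow>
     bij_betw \<phi> S S \<and>
     (\<forall>s\<in>S. \<forall>t\<in>S. diagram_edge W S (\<phi> s) (\<phi> t) \<longleftrightarrow> diagram_edge W S s t) \<and>
     (\<forall>s\<in>S. \<forall>t\<in>S. diagram_edge W S s t \<longrightarrow> cox_m W (\<phi> s) (\<phi> t) = cox_m W s t)"

definition flexible :: "('a, 'b) monoid_scheme \<Rightarrow> 'a set \<Rightarrow> bool" where
  "flexible W S \<longleftrightarrow>
     (\<exists>s\<in>S. \<exists>\<phi>. defining_diagram_aut W S \<phi> \<and> (\<exists>t\<in>S. \<phi> t \<noteq> t) \<and>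
        \<phi> s = s \<and> (\<forall>t\<in>S. diagram_edge W S s t \<longrightarrow> \<phi> t = t))"

subsection \<open>The Cayley graph and its automorphisms\<close>

definition cayley_edges :: "('a, 'b) monoid_scheme \<Rightarrow> 'a set \<Rightarrow> 'a set set" where
  "cayley_edges W S = {{w, w \<otimes>\<^bsub>W\<^esub> s} | w s. w \<in> carrier W \<and> s \<in> S}"

definition cayley_aut_group :: "('a, 'b) monoid_scheme \<Rightarrow> 'a set \<Rightarrow> ('a \<Rightarrow> 'a) monoid" where
  "cayley_aut_group W S = BijGroup (carrier W) \<lparr>carrier :=
     {f \<in> Bij (carrier W). \<forall>x\<in>carrier W. \<forall>y\<in>carrier W.
        {f x, f y} \<in> cayley_edges W S \<longleftrightarrow> {x, y} \<in> cayley_edges W S}\<rparr>"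

definition left_mult_auts :: "('a, 'b) monoid_scheme \<Rightarrow> ('a \<Rightarrow> 'a) set" where
  "left_mult_auts W = {\<lambda>x\<in>carrier W. w \<otimes>\<^bsub>W\<^esub> x | w. w \<in> carrier W}"

definition coxeter_diagram_aut ::
  "('a, 'b) monoid_scheme \<Rightarrow> 'a set \<Rightarrow> ('a \<Rightarrow> 'a) \<Rightarrow> bool" where
  "coxeter_diagram_aut W S \<pi> \<longleftrightarrow>
     bij_betw \<pi> S S \<and> (\<forall>s\<in>S. \<forall>t\<in>S. s \<noteq> t \<longrightarrow> cox_m W (\<pi> s) (\<pi> t) = cox_m W s t)"

definition diagram_auts :: "('a, 'b) monoid_scheme \<Rightarrow> 'a set \<Rightarrow> ('a \<Rightarrow> 'a) set" where
  "diagram_auts W S =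
     {f \<in> auto W. \<exists>\<pi>. coxeter_diagram_aut W S \<pi> \<and> (\<forall>s\<in>S. f s = \<pi> s)}"

definition internal_semidirect_product ::
  "('a, 'b) monoid_scheme \<Rightarrow> 'a set \<Rightarrow> 'a set \<Rightarrow> bool" where
  "internal_semidirect_product G N H \<longleftrightarrow>
     N \<lhd> G \<and> subgroup H G \<and> N \<inter> H = {\<one>\<^bsub>G\<^esub>} \<and> N <#>\<^bsub>G\<^esub> H = carrier G"

end

theory Submission
  imports Defs
begin

text \<open>
  A function on edges with values in \<open>Z/2\<close> whose sum around every relator vanishes integrates to a
  function on \<open>W\<close>. Applied to the walls of the reflections this yields the deletion and exchange
  conditions. They show that, for \<open>s \<noteq> t\<close>, \<open>m\<^sub>s\<^sub>t\<close> is the minimal length of an element with both \<open>s\<close>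
  and \<open>t\<close> as left descents, attained only by the alternating word of length \<open>m\<^sub>s\<^sub>t\<close>. As
  automorphisms of \<open>\<Gamma>\<close> preserve distances, the label permutation induced by an automorphism at a
  vertex \<open>x\<close> is an automorphism of the defining diagram, and the permutations at \<open>x\<close> and \<open>xs\<close> agree
  on \<open>s\<close> and its neighbours. If the diagram is not flexible they coincide, so every automorphism
  fixing \<open>1\<close> is a diagram automorphism.

  Conversely, let \<open>\<phi>\<close> witness flexibility at \<open>s\<close>, and let \<open>H\<close> be the subgroup generated by the
  neighbours of \<open>s\<close>. Removing the edges between \<open>H\<close> and \<open>Hs\<close> separates \<open>\<Gamma>\<close>. Since \<open>\<phi>\<close> fixes \<open>H\<close>
  pointwise, the identity on the side of \<open>s\<close> and \<open>\<phi>\<close> on the side of \<open>1\<close> glue to an automorphism of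
  \<open>\<Gamma>\<close>, which is not in \<open>WD\<close>.
\<close>

section \<open>Words in the generators and the universal property of the presentation\<close>

locale coxeter = group W for W :: "('a, 'b) monoid_scheme" (structure) +
  fixes S :: "'a set"
  assumes presentation: "has_presentation W S (coxeter_relators W S)"
begin

definition lprod :: "'a list \<Rightarrow> 'a" where
  "lprod xs = foldr (\<otimes>) xs \<one>"

lemma gen_closed [simp, intro]: "s \<in> S \<Longrightarrow> s \<in> carrier W"
  using presentation by (auto simp: has_presentation_def)

lemma lprod_Nil [simp]: "lprod [] = \<one>"
  and lprod_Cons [simp]: "lprod (x # xs) = x \<otimes> lprod xs"
  by (simp_all add: lprod_def)

lemma lprod_closed [simp, intro]: "set xs \<subseteq> S \<Longrightarrow> lprod xs \<in> carrier W"
  by (induction xs) auto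

lemma lprod_append [simp]:
  "set xs \<subseteq> S \<Longrightarrow> set ys \<subseteq> S \<Longrightarrow> lprod (xs @ ys) = lprod xs \<otimes> lprod ys"
  by (induction xs) (auto simp: m_assoc)

lemma eval_word_relator:
  assumes "r \<in> coxeter_relators W S"
  shows "eval_word W r = \<one>"
proof -
  have r: "r \<in> words S"
    using assms presentation by (auto simp: has_presentation_def)
  have "elementary_reduction S (coxeter_relators W S) ([] @ r @ []) ([] @ [])"
    by (rule elementary_reduction.relator) (use assms in \<open>auto simp: words_def\<close>)
  then show ?thesis
    using r presentation by (auto simp: has_presentation_def)
qed

lemma gen_square [simp]:
  assumes "s \<in> S" shows "s \<otimes> s = \<one>"
proof -
  have "[(s, True), (s, True)] \<in> coxeter_relators W S"
    using assms by (auto simp: coxeter_relators_def)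
  then have "eval_word W [(s, True), (s, True)] = \<one>"
    by (rule eval_word_relator)
  then show ?thesis
    using assms by (simp add: eval_word_def eval_letter_def)
qed

lemma inv_gen [simp]: "s \<in> S \<Longrightarrow> inv s = s"
  using inv_equality gen_square by blast

lemma gen_mult_cancel [simp]:
  "s \<in> S \<Longrightarrow> x \<in> carrier W \<Longrightarrow> s \<otimes> (s \<otimes> x) = x"
  by (metis gen_closed gen_square l_one m_assoc)

lemma mult_gen_cancel [simp]:
  "s \<in> S \<Longrightarrow> x \<in> carrier W \<Longrightarrow> x \<otimes> s \<otimes> s = x"
  by (simp add: m_assoc)

lemma inv_mult_cancel [simp]:
  "x \<in> carrier W \<Longrightarrow> y \<in> carrier W \<Longrightarrow> inv x \<otimes> (x \<otimes> y) = y"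
  "x \<in> carrier W \<Longrightarrow> y \<in> carrier W \<Longrightarrow> x \<otimes> (inv x \<otimes> y) = y"
  by (simp_all flip: m_assoc)

lemma eval_word_eq_lprod: "w \<in> words S \<Longrightarrow> eval_word W w = lprod (map fst w)"
  by (induction w) (auto simp: words_def eval_word_def eval_letter_def)

lemma lprod_rev: "set xs \<subseteq> S \<Longrightarrow> lprod (rev xs) = inv (lprod xs)"
  by (induction xs) (auto simp: inv_mult_group)

lemma ex_lprod:
  assumes "x \<in> carrier W"
  obtains xs where "set xs \<subseteq> S" "lprod xs = x"
proof -
  have "x \<in> generate W S"
    using assms presentation by (simp add: has_presentation_def)
  then have "\<exists>xs. set xs \<subseteq> S \<and> lprod xs = x"
  proof induction
    case one
    show ?case by (rule exI[of _ "[]"]) auto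
  next
    case (incl h)
    then show ?case by (intro exI[of _ "[h]"]) auto
  next
    case (inv h)
    then show ?case by (intro exI[of _ "[h]"]) auto
  next
    case (eng h1 h2)
    then obtain xs ys where "set xs \<subseteq> S" "set ys \<subseteq> S" "lprod xs = h1" "lprod ys = h2"
      by auto
    then show ?case by (intro exI[of _ "xs @ ys"]) auto
  qed
  with that show ?thesis by blast
qed

lemma carrier_induct [consumes 1, case_names one mult]:
  assumes "x \<in> carrier W" and "P \<one>"
    and "\<And>x s. x \<in> carrier W \<Longrightarrow> s \<in> S \<Longrightarrow> P x \<Longrightarrow> P (x \<otimes> s)"
  shows "P x"
proof -
  obtain xs where xs: "set xs \<subseteq> S" "lprod xs = x"
    using ex_lprod[OF assms(1)] .
  have "set xs \<subseteq> S \<Longrightarrow> P (lprod xs)" for xs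
    by (induction xs rule: rev_induct) (auto intro: assms)
  with xs show ?thesis by blast
qed

text \<open>This is the universal property of the presentation: maps on \<open>Y\<close> that
  satisfy the relations make \<open>Y\<close> a right \<open>W\<close>-set, \<open>fold\<close>
  applying the first letter first. No elementary reduction changes the effect of a word, so a word
  equivalent to the empty one acts trivially.\<close>

lemma fold_action_cong:
  fixes act :: "'a \<Rightarrow> 'x \<Rightarrow> 'x"
  assumes closed: "\<And>s x. s \<in> S \<Longrightarrow> x \<in> Y \<Longrightarrow> act s x \<in> Y"
    and invol: "\<And>s x. s \<in> S \<Longrightarrow> x \<in> Y \<Longrightarrow> act s (act s x) = x"
    and braid: "\<And>s t n x. \<lbrakk>s \<in> S; t \<in> S; s \<noteq> t; cox_m W s t = enat n; x \<in> Y\<rbrakk>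
      \<Longrightarrow> fold act (concat (replicate n [s, t])) x = x"
    and xs: "set xs \<subseteq> S" and ys: "set ys \<subseteq> S" and eq: "lprod xs = lprod ys"
    and x: "x \<in> Y"
  shows "fold act xs x = fold act ys x"
proof -
  have fold_closed: "fold act zs x \<in> Y" if "set zs \<subseteq> S" "x \<in> Y" for zs x
    using that by (induction zs arbitrary: x) (auto intro: closed)
  have step: "fold act (map fst u) x = fold act (map fst v) x"
    if "elementary_reduction S (coxeter_relators W S) u v" "x \<in> Y" for u v x
    using that
  proof cases
    case (cancel u' v' s b)
    then have "fold act (map fst u') x \<in> Y"
      by (intro fold_closed that) (auto simp: words_def)
    with cancel show ?thesis by (simp add: invol)
  next
    case (relator u' v' r)
    then have *: "fold act (map fst u') x \<in> Y"
      by (intro fold_closed that) (auto simp: words_def)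
    have "fold act (map fst r) y = y" if "y \<in> Y" for y
      using \<open>r \<in> coxeter_relators W S\<close> that invol braid
      by (auto simp: coxeter_relators_def map_concat)
    with relator * show ?thesis by simp
  qed
  have equiv: "fold act (map fst u) x = fold act (map fst v) x"
    if "equivclp (elementary_reduction S (coxeter_relators W S)) u v" "x \<in> Y" for u v x
    using that by (induction rule: equivclp_induct) (auto dest: step)
  have fold_rev: "fold act zs (fold act (rev zs) z) = z" if "set zs \<subseteq> S" "z \<in> Y" for zs z
    using that
  proof (induction zs arbitrary: z)
    case (Cons a zs)
    then show ?case
      using invol fold_closed[of "rev zs" z] by auto
  qed simp
  \<comment> \<open>Generators are involutions, so \<open>rev ys\<close> spells the inverse of
    \<open>lprod ys\<close> with positive letters only, and \<open>w\<close> represents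
    \<open>\<one>\<close>.\<close>
  define w where "w = map (\<lambda>s. (s, True)) (xs @ rev ys)"
  have w: "w \<in> words S" "map fst w = xs @ rev ys"
    using xs ys by (auto simp: w_def words_def comp_def)
  have "eval_word W w = \<one>"
    using eval_word_eq_lprod[OF w(1)] w(2) xs ys eq by (simp add: lprod_rev)
  then have "equivclp (elementary_reduction S (coxeter_relators W S)) w []"
    using presentation w(1) by (auto simp: has_presentation_def)
  from equiv[OF this x] have "fold act (rev ys) (fold act xs x) = x"
    using w(2) by simp
  then show ?thesis
    using fold_rev[OF ys fold_closed[OF xs x]] by simp
qed

end

section \<open>Alternating words and a parity count\<close>

fun alt :: "'a \<Rightarrow> 'a \<Rightarrow> nat \<Rightarrow> 'a list" where
  "alt s t 0 = []"
| "alt s t (Suc n) = s # alt t s n"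

lemma length_alt [simp]: "length (alt s t n) = n"
  by (induction s t n rule: alt.induct) auto

lemma set_alt_subset [simp, intro]: "s \<in> A \<Longrightarrow> t \<in> A \<Longrightarrow> set (alt s t n) \<subseteq> A"
  by (induction s t n rule: alt.induct) auto

lemma concat_replicate_eq_alt: "concat (replicate n [s, t]) = alt s t (2 * n)"
  by (induction n) auto

lemma alt_add: "alt s t (m + n) = alt s t m @ (if even m then alt s t n else alt t s n)"
  by (induction s t m rule: alt.induct) auto

lemma rev_alt: "rev (alt s t n) = (if even n then alt t s n else alt s t n)"
proof (induction n arbitrary: s t)
  case (Suc n)
  have "alt a b (Suc n) = alt a b n @ [if even n then a else b]" for a b
    using alt_add[of a b n 1] by auto
  from this[of s t] show ?case
    using Suc[of s t] by auto
qed simp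

lemma take_alt: "j \<le> n \<Longrightarrow> take j (alt s t n) = alt s t j"
  using alt_add[of s t j "n - j"] by auto

text \<open>The shift by \<open>n\<close> matches the solutions below \<open>n\<close> with those
  from \<open>n\<close> to \<open>2 * n - 1\<close>.\<close>

lemma even_card_periodic:
  fixes P :: "nat \<Rightarrow> bool"
  assumes "\<And>i. P (i + n) = P i"
  shows "even (card {i. i < 2 * n \<and> P i})"
proof -
  have "{i. i < 2 * n \<and> P i} = {i. i < n \<and> P i} \<union> (\<lambda>i. i + n) ` {i. i < n \<and> P i}"
  proof (intro Set.set_eqI iffI)
    fix i assume "i \<in> {i. i < 2 * n \<and> P i}"
    then show "i \<in> {i. i < n \<and> P i} \<union> (\<lambda>i. i + n) ` {i. i < n \<and> P i}"
      using assms[of "i - n"] by (cases "i < n") (auto intro!: image_eqI[of _ _ "i - n"])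
  next
    fix i assume "i \<in> {i. i < n \<and> P i} \<union> (\<lambda>i. i + n) ` {i. i < n \<and> P i}"
    then show "i \<in> {i. i < 2 * n \<and> P i}"
      using assms by fastforce
  qed
  moreover have "card ((\<lambda>i. i + n) ` {i. i < n \<and> P i}) = card {i. i < n \<and> P i}"
    by (rule card_image) simp
  moreover have "{i. i < n \<and> P i} \<inter> (\<lambda>i. i + n) ` {i. i < n \<and> P i} = {}"
    by auto
  ultimately have "card {i. i < 2 * n \<and> P i} = card {i. i < n \<and> P i} + card {i. i < n \<and> P i}"
    by (simp add: card_Un_disjoint)
  then show ?thesis by simp
qed

context coxeter
begin

lemma lprod_alt_double:
  assumes "s \<in> S" "t \<in> S" shows "lprod (alt s t (2 * n)) = (s \<otimes> t) [^] n"
proof (induction n)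
  case (Suc n)
  have "lprod (alt s t (2 * Suc n)) = (s \<otimes> t) \<otimes> (s \<otimes> t) [^] n"
    using Suc assms by (simp add: m_assoc)
  then show ?case using assms nat_pow_Suc2[of "s \<otimes> t" n] by simp
qed simp

lemma cox_m_pow:
  assumes "s \<in> S" "t \<in> S" "cox_m W s t = enat n"
  shows "(s \<otimes> t) [^] n = \<one>" and "n > 0"
  using assms by (auto simp: cox_m_def pow_eq_id split: if_splits)

subsection \<open>Mod 2 cocycles\<close>

text \<open>A cochain \<open>f\<close> takes the value \<open>f x t\<close> on the edge from \<open>x\<close> to \<open>x \<otimes> t\<close>.\<close>

fun path_sum :: "('a \<Rightarrow> 'a \<Rightarrow> bool) \<Rightarrow> 'a list \<Rightarrow> 'a \<Rightarrow> bool" where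
  "path_sum f [] x = False"
| "path_sum f (t # ts) x = (f x t \<noteq> path_sum f ts (x \<otimes> t))"

lemma path_sum_append:
  "set xs \<subseteq> S \<Longrightarrow> set ys \<subseteq> S \<Longrightarrow> x \<in> carrier W \<Longrightarrow>
   path_sum f (xs @ ys) x = (path_sum f xs x \<noteq> path_sum f ys (x \<otimes> lprod xs))"
  by (induction xs arbitrary: x) (auto simp: m_assoc)

text \<open>The assumptions say that \<open>f\<close> is a well-defined function on unoriented edges
  with sum zero around every relator \<open>(st)^n\<close>. Such an \<open>f\<close> describes a
  double cover of the Cayley graph on which \<open>W\<close> acts, and two words for the same
  element end at the same point of it.\<close>

lemma path_sum_cong:
  assumes sym: "\<And>x t. x \<in> carrier W \<Longrightarrow> t \<in> S \<Longrightarrow> f (x \<otimes> t) t = f x t"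
    and braid: "\<And>s t n x. \<lbrakk>s \<in> S; t \<in> S; s \<noteq> t; cox_m W s t = enat n; x \<in> carrier W\<rbrakk>
      \<Longrightarrow> \<not> path_sum f (alt s t (2 * n)) x"
    and xs: "set xs \<subseteq> S" and ys: "set ys \<subseteq> S" and eq: "lprod xs = lprod ys"
    and x: "x \<in> carrier W"
  shows "path_sum f xs x = path_sum f ys x"
proof -
  \<comment> \<open>The Boolean component records the sheet of the double cover; a letter moves
    along its edge and adds the value of \<open>f\<close> there.\<close>
  define act where "act = (\<lambda>t (x, b). (x \<otimes> t, b \<noteq> f x t))"
  have fold_act: "fold act zs (x, b) = (x \<otimes> lprod zs, b \<noteq> path_sum f zs x)"
    if "set zs \<subseteq> S" "x \<in> carrier W" for zs x b
    using that by (induction zs arbitrary: x b) (auto simp: act_def m_assoc)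
  have "fold act xs (x, False) = fold act ys (x, False)"
  proof (rule fold_action_cong[where Y = "carrier W \<times> UNIV"])
    fix s t n and y :: "'a \<times> bool"
    assume *: "s \<in> S" "t \<in> S" "s \<noteq> t" "cox_m W s t = enat n" "y \<in> carrier W \<times> UNIV"
    have one: "lprod (alt s t (2 * n)) = \<one>"
      using * by (simp add: lprod_alt_double cox_m_pow)
    obtain x b where y: "y = (x, b)" "x \<in> carrier W" using * by auto
    show "fold act (concat (replicate n [s, t])) y = y"
      unfolding concat_replicate_eq_alt y(1)
      using fold_act[OF set_alt_subset[OF *(1,2)] y(2)] braid[OF *(1-4) y(2)] one y(2) by simp
  qed (use assms in \<open>auto simp: act_def sym\<close>)
  then show ?thesis
    using fold_act xs ys x by simp
qed

text \<open>The constant cochain measures the parity of word length. All relators have even length,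
  whereas \<open>[s]\<close> has length one.\<close>

lemma gen_neq_one:
  assumes "s \<in> S" shows "s \<noteq> \<one>"
proof
  assume *: "s = \<one>"
  have "path_sum (\<lambda>x t. True) (alt s t (2 * n)) x = False" for s t n x
    by (induction n arbitrary: x) auto
  then have "path_sum (\<lambda>x t. True) [s] \<one> = path_sum (\<lambda>x t. True) [] \<one>"
    by (intro path_sum_cong) (use assms * in auto)
  then show False by simp
qed

subsection \<open>Reflections and reduced words\<close>

text \<open>This is the reflection whose wall is crossed by edge number \<open>i\<close>, counted
  from 0, of the path that starts at \<open>\<one>\<close> and is labelled by
  \<open>xs\<close>.\<close>

definition refl_at :: "'a list \<Rightarrow> nat \<Rightarrow> 'a" where
  "refl_at xs i = lprod (take i xs) \<otimes> xs ! i \<otimes> inv (lprod (take i xs))"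

lemma set_take_gens [simp]: "set xs \<subseteq> S \<Longrightarrow> set (take i xs) \<subseteq> S"
  by (auto dest: in_set_takeD)

lemma nth_gens [simp]: "set xs \<subseteq> S \<Longrightarrow> i < length xs \<Longrightarrow> xs ! i \<in> S"
  by auto

lemma refl_at_closed [simp, intro]:
  "set xs \<subseteq> S \<Longrightarrow> i < length xs \<Longrightarrow> refl_at xs i \<in> carrier W"
  by (simp add: refl_at_def)

lemma refl_at_Cons_0: "s \<in> S \<Longrightarrow> refl_at (s # xs) 0 = s"
  by (simp add: refl_at_def)

lemma refl_at_Cons_Suc:
  assumes "s \<in> S" "set xs \<subseteq> S" "i < length xs"
  shows "refl_at (s # xs) (Suc i) = s \<otimes> refl_at xs i \<otimes> s"
proof -
  have "lprod (take i xs) \<in> carrier W" "xs ! i \<in> carrier W"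
    using assms set_take_gens[of xs i] by auto
  then show ?thesis
    using assms by (simp add: refl_at_def inv_mult_group m_assoc)
qed

text \<open>The cochain marks the edges crossed by the wall of \<open>r\<close>, so its sum along a
  path is the parity of the number of crossings. The conjugation by \<open>x\<close> moves the start
  of the path from \<open>\<one>\<close> to \<open>x\<close>.\<close>

lemma path_sum_refl:
  assumes "set xs \<subseteq> S" "x \<in> carrier W"
  shows "path_sum (\<lambda>x t. x \<otimes> t \<otimes> inv x = r) xs x \<longleftrightarrow>
    odd (card {i. i < length xs \<and> x \<otimes> refl_at xs i \<otimes> inv x = r})"
  using assms
proof (induction xs arbitrary: x)
  case (Cons a xs)
  let ?P = "\<lambda>i. x \<otimes> refl_at (a # xs) i \<otimes> inv x = r"
  let ?Q = "\<lambda>i. (x \<otimes> a) \<otimes> refl_at xs i \<otimes> inv (x \<otimes> a) = r"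
  have a: "a \<in> S" "a \<in> carrier W" using Cons by auto
  have Q: "?P (Suc i) = ?Q i" if "i < length xs" for i
  proof -
    have xs: "set xs \<subseteq> S" using Cons.prems by simp
    show ?thesis
      unfolding refl_at_Cons_Suc[OF a(1) xs that]
      using Cons.prems a refl_at_closed[OF xs that] by (simp add: inv_mult_group m_assoc)
  qed
  have "{i. i < length (a # xs) \<and> ?P i} =
      (if ?P 0 then {0} else {}) \<union> Suc ` {i. i < length xs \<and> ?Q i}"
    (is "?l = ?r")
  proof (rule Set.set_eqI)
    fix i show "i \<in> ?l \<longleftrightarrow> i \<in> ?r"
    proof (cases i)
      case (Suc k)
      show ?thesis unfolding Suc using Q[of k] by auto
    qed auto
  qed
  moreover have "card (Suc ` {i. i < length xs \<and> ?Q i}) = card {i. i < length xs \<and> ?Q i}"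
    by (rule card_image) simp
  ultimately have "card {i. i < length (a # xs) \<and> ?P i} =
      (if ?P 0 then 1 else 0) + card {i. i < length xs \<and> ?Q i}"
    by (simp add: card_insert_if)
  moreover have "?P 0 \<longleftrightarrow> x \<otimes> a \<otimes> inv x = r"
    using a by (simp add: refl_at_Cons_0)
  ultimately show ?case
    using Cons a by simp
qed simp

lemma gen_pow_swap:
  assumes "s \<in> carrier W" "t \<in> carrier W"
  shows "s \<otimes> (t \<otimes> s) [^] (i::nat) = (s \<otimes> t) [^] i \<otimes> s"
proof (induction i)
  case (Suc i)
  have "s \<otimes> (t \<otimes> s) [^] Suc i = (s \<otimes> (t \<otimes> s) [^] i) \<otimes> (t \<otimes> s)"
    using assms by (simp add: m_assoc)
  also have "\<dots> = (s \<otimes> t) [^] Suc i \<otimes> s"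
    using assms by (simp add: Suc m_assoc)
  finally show ?case .
qed (use assms in simp)

lemma refl_at_alt:
  assumes "s \<in> S" "t \<in> S" "i < n"
  shows "refl_at (alt s t n) i = (s \<otimes> t) [^] i \<otimes> s"
  using assms
proof (induction i arbitrary: s t n)
  case 0
  then show ?case by (cases n) (auto simp: refl_at_Cons_0)
next
  case (Suc i)
  then obtain m where m: "n = Suc m" by (cases n) auto
  have "refl_at (alt s t n) (Suc i) = s \<otimes> ((t \<otimes> s) [^] i \<otimes> t) \<otimes> s"
    using Suc m refl_at_Cons_Suc[of s "alt t s m" i] set_alt_subset[of t S s m] by simp
  also have "\<dots> = s \<otimes> (t \<otimes> s) [^] i \<otimes> (t \<otimes> s)"
    using Suc.prems by (simp add: m_assoc)
  also have "\<dots> = (s \<otimes> t) [^] Suc i \<otimes> s"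
    using Suc.prems by (simp add: gen_pow_swap m_assoc)
  finally show ?case .
qed

text \<open>The walls met around the relator \<open>(st)^n\<close> belong to \<open>(st)^i s\<close>
  for \<open>i < 2 * n\<close>. These repeat with period \<open>n\<close>, so each wall is crossed
  an even number of times and the crossing parity is a cocycle.\<close>

lemma path_sum_refl_cong:
  assumes "set xs \<subseteq> S" "set ys \<subseteq> S" "lprod xs = lprod ys" "x \<in> carrier W"
  shows "path_sum (\<lambda>x t. x \<otimes> t \<otimes> inv x = r) xs x = path_sum (\<lambda>x t. x \<otimes> t \<otimes> inv x = r) ys x"
proof (rule path_sum_cong)
  fix s t n x
  assume *: "s \<in> S" "t \<in> S" "s \<noteq> t" "cox_m W s t = enat n" "x \<in> carrier W"
  have "even (card {i. i < 2 * n \<and> x \<otimes> ((s \<otimes> t) [^] i \<otimes> s) \<otimes> inv x = r})"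
    using * by (intro even_card_periodic) (simp flip: nat_pow_mult add: cox_m_pow)
  also have "{i. i < 2 * n \<and> x \<otimes> ((s \<otimes> t) [^] i \<otimes> s) \<otimes> inv x = r} =
     {i. i < length (alt s t (2 * n)) \<and> x \<otimes> refl_at (alt s t (2 * n)) i \<otimes> inv x = r}"
    using * by (auto simp: refl_at_alt)
  finally show "\<not> path_sum (\<lambda>x t. x \<otimes> t \<otimes> inv x = r) (alt s t (2 * n)) x"
    using * by (subst path_sum_refl) auto
qed (use assms in \<open>auto simp: inv_mult_group m_assoc\<close>)

text \<open>A wall that \<open>xs\<close> crosses exactly once is crossed an odd number of times,
  hence at least once, by every other path with the same ends. Thus \<open>ys\<close> has at least
  as many edges as \<open>xs\<close> has walls.\<close>

lemma inj_refl_at_imp_length_le: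
  assumes xs: "set xs \<subseteq> S" and ys: "set ys \<subseteq> S" and eq: "lprod xs = lprod ys"
    and inj: "inj_on (refl_at xs) {..<length xs}"
  shows "length xs \<le> length ys"
proof -
  have "refl_at xs ` {..<length xs} \<subseteq> refl_at ys ` {..<length ys}"
  proof
    fix r assume "r \<in> refl_at xs ` {..<length xs}"
    then obtain j where j: "j < length xs" "r = refl_at xs j" by auto
    have "{i. i < length xs \<and> refl_at xs i = r} = {j}"
      using inj j by (auto simp: inj_on_def)
    moreover have "{i. i < length zs \<and> \<one> \<otimes> refl_at zs i \<otimes> inv \<one> = r} =
        {i. i < length zs \<and> refl_at zs i = r}" if "set zs \<subseteq> S" for zs
      using that by auto
    ultimately have "odd (card {i. i < length ys \<and> refl_at ys i = r})"
      using path_sum_refl_cong[OF xs ys eq one_closed, of r] xs ys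
      by (simp add: path_sum_refl)
    then have "{i. i < length ys \<and> refl_at ys i = r} \<noteq> {}" by force
    then show "r \<in> refl_at ys ` {..<length ys}" by auto
  qed
  then have "card (refl_at xs ` {..<length xs}) \<le> card (refl_at ys ` {..<length ys})"
    by (intro card_mono) auto
  also have "\<dots> \<le> length ys"
    using card_image_le[of "{..<length ys}" "refl_at ys"] by simp
  finally show ?thesis
    using inj by (simp add: card_image)
qed

section \<open>Word length, deletion and exchange\<close>

definition len :: "'a \<Rightarrow> nat" where
  "len x = (LEAST n. \<exists>xs. set xs \<subseteq> S \<and> length xs = n \<and> lprod xs = x)"

lemma len_lprod_le: "set xs \<subseteq> S \<Longrightarrow> len (lprod xs) \<le> length xs"
  unfolding len_def by (rule Least_le) auto

lemma ex_reduced: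
  assumes "x \<in> carrier W"
  obtains xs where "set xs \<subseteq> S" "lprod xs = x" "length xs = len x"
proof -
  obtain xs where "set xs \<subseteq> S" "lprod xs = x"
    using ex_lprod[OF assms] .
  then have "\<exists>n. \<exists>xs. set xs \<subseteq> S \<and> length xs = n \<and> lprod xs = x" by auto
  then have "\<exists>xs. set xs \<subseteq> S \<and> length xs = len x \<and> lprod xs = x"
    unfolding len_def by (rule LeastI_ex)
  with that show ?thesis by auto
qed

lemma nonreduced_refl_at_eq:
  assumes "set xs \<subseteq> S" "len (lprod xs) < length xs"
  obtains i j where "i < j" "j < length xs" "refl_at xs i = refl_at xs j"
proof -
  obtain ys where ys: "set ys \<subseteq> S" "lprod ys = lprod xs" "length ys = len (lprod xs)"
    using ex_reduced[of "lprod xs"] assms by auto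
  then have "\<not> inj_on (refl_at xs) {..<length xs}"
    using inj_refl_at_imp_length_le[of xs ys] assms by auto
  then obtain i j where "i < length xs" "j < length xs" "i \<noteq> j" "refl_at xs i = refl_at xs j"
    by (auto simp: inj_on_def)
  with that show ?thesis by (metis linorder_neqE_nat)
qed

text \<open>A non-reduced word crosses some wall twice. With \<open>A\<close> and \<open>B\<close>
  the products of \<open>as\<close> and \<open>bs\<close>, this says that \<open>A a A^-1\<close>
  equals the conjugate of \<open>b\<close> by \<open>A a B\<close>; cancelling leaves
  \<open>a B = B b\<close>. As \<open>a\<close> is an involution, \<open>a B b = B\<close>, so both
  letters can be deleted.\<close>

lemma nonreduced_split:
  assumes xs: "set xs \<subseteq> S" and "len (lprod xs) < length xs"
  obtains as a bs b cs where "xs = as @ a # bs @ b # cs" "lprod bs \<otimes> b = a \<otimes> lprod bs"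
proof -
  obtain i j where ij: "i < j" "j < length xs" "refl_at xs i = refl_at xs j"
    using nonreduced_refl_at_eq[OF assms] .
  define as where "as = take i xs"
  define bs where "bs = drop (Suc i) (take j xs)"
  define cs where "cs = drop (Suc j) xs"
  have pre: "take j xs = as @ xs ! i # bs"
    unfolding as_def bs_def using ij id_take_nth_drop[of i "take j xs"] by (simp add: min_def)
  have split: "xs = as @ xs ! i # bs @ xs ! j # cs"
    using pre id_take_nth_drop[of j xs] ij by (simp add: cs_def)
  have "set xs \<subseteq> S" using xs by auto
  then have S: "set as \<subseteq> S" "set bs \<subseteq> S" "xs ! i \<in> S" "xs ! j \<in> S"
    using ij by (subst (asm) split, auto)+
  define A B a b where "A = lprod as" and "B = lprod bs" and "a = xs ! i" and "b = xs ! j"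
  have c: "A \<in> carrier W" "B \<in> carrier W" "a \<in> carrier W" "b \<in> carrier W" "a \<in> S" "b \<in> S"
    using S by (auto simp: A_def B_def a_def b_def)
  have "A \<otimes> a \<otimes> inv A = (A \<otimes> (a \<otimes> B)) \<otimes> b \<otimes> inv (A \<otimes> (a \<otimes> B))"
    using ij(3) S unfolding refl_at_def pre as_def[symmetric]
    by (simp add: A_def B_def a_def b_def)
  then have "A \<otimes> (a \<otimes> inv A) = A \<otimes> (a \<otimes> (B \<otimes> (b \<otimes> (inv B \<otimes> (a \<otimes> inv A)))))"
    using c by (simp add: inv_mult_group m_assoc)
  then have "a \<otimes> inv A = a \<otimes> (B \<otimes> (b \<otimes> (inv B \<otimes> (a \<otimes> inv A))))"
    using c by (subst (asm) l_cancel) auto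
  then have "inv A = B \<otimes> (b \<otimes> (inv B \<otimes> (a \<otimes> inv A)))"
    using c by (subst (asm) l_cancel) auto
  then have "\<one> \<otimes> inv A = (B \<otimes> b \<otimes> inv B \<otimes> a) \<otimes> inv A"
    using c by (simp add: m_assoc)
  then have "\<one> = B \<otimes> b \<otimes> inv B \<otimes> a"
    using c right_cancel[of "inv A" "\<one>" "B \<otimes> b \<otimes> inv B \<otimes> a"] by auto
  then have "\<one> \<otimes> (a \<otimes> B) = B \<otimes> b \<otimes> inv B \<otimes> a \<otimes> (a \<otimes> B)" by simp
  then have "a \<otimes> B = B \<otimes> b"
    using c by (simp add: m_assoc)
  then show ?thesis
    using that[OF split] by (simp add: B_def a_def b_def)
qed

text \<open>Deletion shortens a word over \<open>L\<close> for \<open>s\<close> and stays inside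
  \<open>L\<close>. It can be repeated until one letter is left; the empty word is impossible since
  \<open>s\<close> is not \<open>\<one>\<close>.\<close>

lemma lprod_in_gens:
  assumes "L \<subseteq> S" "set xs \<subseteq> L" "s \<in> S" "lprod xs = s"
  shows "s \<in> L"
  using assms
proof (induction "length xs" arbitrary: xs rule: less_induct)
  case less
  have xs: "set xs \<subseteq> S" using less by auto
  consider "xs = []" | a where "xs = [a]" | "length xs \<ge> 2"
    by (cases xs; cases "tl xs") auto
  then show ?case
  proof cases
    case 1
    then show ?thesis using less.prems gen_neq_one by auto
  next
    case 2
    then show ?thesis using less.prems by auto
  next
    case 3
    have "len s \<le> 1" using len_lprod_le[of "[s]"] less.prems by auto
    then have "len (lprod xs) < length xs" using 3 less.prems by auto
    from nonreduced_split[OF xs this]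
    obtain as a bs b cs where *: "xs = as @ a # bs @ b # cs" "lprod bs \<otimes> b = a \<otimes> lprod bs" .
    have "lprod (bs @ b # cs) = a \<otimes> lprod (bs @ cs)"
      using * xs by (simp flip: m_assoc)
    then have "lprod (as @ bs @ cs) = s"
      using * xs less.prems(4) by simp
    then show ?thesis
      using less * by (intro less.hyps[of "as @ bs @ cs"]) auto
  qed
qed

text \<open>Apply deletion to the non-reduced word \<open>s # ys\<close>. One of the two deleted
  letters must be the leading \<open>s\<close>, since otherwise \<open>ys\<close> itself could be
  shortened.\<close>

lemma exchange:
  assumes ys: "set ys \<subseteq> S" "length ys = len (lprod ys)" and s: "s \<in> S"
    and less: "len (s \<otimes> lprod ys) < len (lprod ys)"
  obtains bs b cs where "ys = bs @ b # cs" "lprod bs \<otimes> b = s \<otimes> lprod bs"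
proof -
  have "set (s # ys) \<subseteq> S" "len (lprod (s # ys)) < length (s # ys)"
    using assms by auto
  from nonreduced_split[OF this]
  obtain as a bs b cs where *: "s # ys = as @ a # bs @ b # cs" "lprod bs \<otimes> b = a \<otimes> lprod bs" .
  show ?thesis
  proof (cases as)
    case Nil
    then show ?thesis using * that by auto
  next
    case (Cons c as')
    then have ys': "ys = as' @ a # bs @ b # cs" using * by auto
    have "lprod (bs @ b # cs) = a \<otimes> lprod (bs @ cs)"
      using * ys ys' by (simp flip: m_assoc)
    then have "lprod (as' @ bs @ cs) = lprod ys"
      using ys ys' by simp
    moreover have "set (as' @ bs @ cs) \<subseteq> S" using ys ys' by auto
    ultimately have "len (lprod ys) \<le> length (as' @ bs @ cs)"
      by (metis len_lprod_le)
    then show ?thesis using ys ys' by simp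
  qed
qed

subsection \<open>Dihedral subgroups\<close>

lemma cox_m_commute:
  assumes "s \<in> S" "t \<in> S"
  shows "cox_m W s t = cox_m W t s"
proof -
  have "inv (s \<otimes> t) = t \<otimes> s" using assms by (simp add: inv_mult_group)
  then have "ord (t \<otimes> s) = ord (s \<otimes> t)" using assms ord_inv[of "s \<otimes> t"] by simp
  then show ?thesis by (simp add: cox_m_def)
qed

text \<open>A repeated wall along the alternating word gives \<open>(st)^i = (st)^j\<close> with
  \<open>i < j < k\<close>, which the order of \<open>st\<close> rules out.\<close>

lemma len_alt:
  assumes "s \<in> S" "t \<in> S" "enat k \<le> cox_m W s t"
  shows "len (lprod (alt s t k)) = k"
proof (rule ccontr)
  have st: "s \<otimes> t \<in> carrier W" using assms by simp
  assume "len (lprod (alt s t k)) \<noteq> k"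
  then have "len (lprod (alt s t k)) < length (alt s t k)"
    using len_lprod_le[of "alt s t k"] assms by simp
  from nonreduced_refl_at_eq[OF _ this] assms
  obtain i j where ij: "i < j" "j < k" "refl_at (alt s t k) i = refl_at (alt s t k) j"
    by auto
  then have "(s \<otimes> t) [^] i \<otimes> s = (s \<otimes> t) [^] j \<otimes> s"
    using assms by (simp add: refl_at_alt)
  then have "(s \<otimes> t) [^] i = (s \<otimes> t) [^] j"
    using assms right_cancel[of s "(s \<otimes> t) [^] i" "(s \<otimes> t) [^] j"] by auto
  also have "\<dots> = (s \<otimes> t) [^] i \<otimes> (s \<otimes> t) [^] (j - i)"
    using st ij by (simp add: nat_pow_mult)
  finally have "(s \<otimes> t) [^] (j - i) = \<one>"
    using st l_cancel_one'[of "(s \<otimes> t) [^] i" "(s \<otimes> t) [^] (j - i)"] by simp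
  then have "ord (s \<otimes> t) dvd j - i" using st pow_eq_id by auto
  \<comment> \<open>The value 0 encodes infinite order; it is excluded because 0 divides only 0 and
    \<open>i < j\<close>.\<close>
  then have "ord (s \<otimes> t) \<noteq> 0" "ord (s \<otimes> t) \<le> j - i"
    using ij by (auto intro!: gr0I dest: dvd_imp_le)
  with assms(3) ij show False by (simp add: cox_m_def)
qed

text \<open>Cut the relator \<open>(st)^n\<close> in the middle: its second half is the reversal of
  \<open>alt t s n\<close> and so represents the inverse of that element.\<close>

lemma alt_braid:
  assumes "s \<in> S" "t \<in> S" "cox_m W s t = enat n"
  shows "lprod (alt s t n) = lprod (alt t s n)"
proof -
  have "alt s t n @ rev (alt t s n) = alt s t (2 * n)"
    using alt_add[of s t n n] by (simp add: rev_alt mult_2)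
  then have "lprod (alt s t n) \<otimes> lprod (rev (alt t s n)) = \<one>"
    using assms lprod_append[of "alt s t n" "rev (alt t s n)"]
    by (simp add: lprod_alt_double cox_m_pow)
  then have "lprod (alt s t n) \<otimes> inv (lprod (alt t s n)) = \<one>"
    using assms by (simp add: lprod_rev)
  then show ?thesis
    using assms by (metis inv_closed inv_equality inv_inv lprod_closed set_alt_subset)
qed

text \<open>By the braid relation the element has reduced words starting with either letter, and
  multiplying by that letter removes it.\<close>

lemma alt_descent:
  assumes "s \<in> S" "t \<in> S" "cox_m W s t = enat n"
  shows "len (lprod (alt s t n)) = n" "len (s \<otimes> lprod (alt s t n)) < n"
    "len (t \<otimes> lprod (alt s t n)) < n"
proof -
  show "len (lprod (alt s t n)) = n" using assms len_alt by simp
  obtain k where k: "n = Suc k" using cox_m_pow(2)[OF assms] by (cases n) auto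
  have "len (a \<otimes> lprod (alt a b n)) < n" if "a \<in> S" "b \<in> S" for a b
    using len_lprod_le[of "alt b a k"] that by (simp add: k)
  then show "len (s \<otimes> lprod (alt s t n)) < n" "len (t \<otimes> lprod (alt s t n)) < n"
    using assms alt_braid[OF assms] by metis+
qed

lemma two_descents:
  assumes s: "s \<in> S" and t: "t \<in> S" and z: "z \<in> carrier W"
    and desc: "len (s \<otimes> z) < len z" "len (t \<otimes> z) < len z" and "s \<noteq> t"
  shows "cox_m W s t \<le> enat (len z)"
    and "cox_m W s t = enat (len z) \<Longrightarrow> z = lprod (alt s t (len z))"
proof -
  \<comment> \<open>Take a reduced word for \<open>z\<close> whose alternating prefix in \<open>s, t\<close> is as long as possible.
    Exchanging against the letter that does not start the prefix cannot lengthen it, so a letter of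
    the prefix is deleted, and prepending that letter to the prefix gives a non-reduced word.\<close>
  define Q where "Q k \<longleftrightarrow> (\<exists>a b zs. {a, b} = {s, t} \<and> set zs \<subseteq> S \<and>
     lprod (alt a b k @ zs) = z \<and> k + length zs = len z)" for k
  obtain zs0 where "set zs0 \<subseteq> S" "lprod zs0 = z" "length zs0 = len z"
    using ex_reduced[OF z] .
  then have "Q 0" unfolding Q_def by (intro exI[of _ s] exI[of _ t] exI[of _ zs0]) simp
  moreover have Q_le: "k \<le> len z" if "Q k" for k using that by (auto simp: Q_def)
  ultimately obtain K where K: "Q K" "\<And>k. Q k \<Longrightarrow> k \<le> K"
    using Nat.ex_has_greatest_nat[of Q 0 "len z"] by blast
  then obtain a b zs where ab: "{a, b} = {s, t}" and zs: "set zs \<subseteq> S"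
      "lprod (alt a b K @ zs) = z" "K + length zs = len z"
    by (auto simp: Q_def)
  have abS: "a \<in> S" "b \<in> S" using ab s t by auto
  have m_ab: "cox_m W b a = cox_m W s t" "cox_m W a b = cox_m W s t"
    using ab cox_m_commute s t by (auto simp: doubleton_eq_iff)
  have "len (b \<otimes> z) < len z" using ab desc by (auto simp: doubleton_eq_iff)
  then obtain bs c cs where split: "alt a b K @ zs = bs @ c # cs"
    and ex: "lprod bs \<otimes> c = b \<otimes> lprod bs"
    using exchange[of "alt a b K @ zs" b] zs abS by auto
  have "set (bs @ c # cs) \<subseteq> S" using split[symmetric] zs abS by simp
  then have bcs: "set bs \<subseteq> S" "c \<in> S" "set cs \<subseteq> S" by auto
  have "length bs < K"
  proof (rule ccontr)
    assume "\<not> length bs < K"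
    then have "take K bs = alt a b K" and zs': "zs = drop K bs @ c # cs"
      using arg_cong[OF split, of "take K"] arg_cong[OF split, of "drop K"] by simp_all
    then have bs: "bs = alt a b K @ drop K bs" by (metis append_take_drop_id)
    have drop: "set (drop K bs) \<subseteq> S" using bcs by (meson set_drop_subset subset_trans)
    have "z = lprod bs \<otimes> c \<otimes> lprod cs"
      using zs split bcs by (simp add: m_assoc)
    also have "\<dots> = b \<otimes> lprod (alt a b K @ drop K bs) \<otimes> lprod cs"
      using ex bs by simp
    also have "\<dots> = lprod (alt b a (Suc K) @ (drop K bs @ cs))"
      using abS bcs drop by (simp add: m_assoc)
    finally have "lprod (alt b a (Suc K) @ (drop K bs @ cs)) = z" ..
    moreover have "{b, a} = {s, t}" using ab by (simp add: insert_commute)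
    moreover have "Suc K + length (drop K bs @ cs) = len z"
      using zs(3) unfolding zs' by simp
    moreover have "set (drop K bs @ cs) \<subseteq> S" using bcs drop by simp
    ultimately have "Q (Suc K)" unfolding Q_def by blast
    then show False using K(2)[of "Suc K"] by simp
  qed
  define j where "j = length bs"
  have "take (Suc j) (alt a b K @ zs) = bs @ [c]"
    unfolding split by (simp add: j_def)
  then have alt_j: "alt a b (Suc j) = bs @ [c]"
    using \<open>length bs < K\<close> by (simp add: j_def take_alt)
  have "lprod (alt b a (Suc (Suc j))) = b \<otimes> lprod (bs @ [c])"
    using alt_j by simp
  also have "\<dots> = lprod bs"
    using bcs abS ex by simp
  finally have "len (lprod (alt b a (Suc (Suc j)))) < Suc (Suc j)"
    using len_lprod_le[OF bcs(1)] by (simp add: j_def)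
  then have "\<not> enat (Suc (Suc j)) \<le> cox_m W b a"
    using len_alt[OF abS(2,1)] by force
  then have "cox_m W s t < enat (Suc (Suc j))" using m_ab by simp
  \<comment> \<open>The strict bound by \<open>j + 2\<close> and \<open>j < K\<close> together give
    the bound by \<open>K\<close>.\<close>
  also have "\<dots> \<le> enat (Suc K)" using \<open>length bs < K\<close> by (simp add: j_def)
  finally have le_K: "cox_m W s t \<le> enat K" by (cases "cox_m W s t") auto
  then show "cox_m W s t \<le> enat (len z)"
    using Q_le[OF K(1)] order_trans by fastforce
  show "z = lprod (alt s t (len z))" if "cox_m W s t = enat (len z)"
  proof -
    \<comment> \<open>The alternating prefix now is the whole word, so \<open>zs\<close> is empty.
      Which letter comes first is immaterial by \<open>alt_braid\<close>.\<close>
    have "K = len z" using that le_K Q_le[OF K(1)] by simp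
    then have "z = lprod (alt a b (len z))" using zs by simp
    then show ?thesis
      using ab alt_braid[OF s t that] by (auto simp: doubleton_eq_iff)
  qed
qed

subsection \<open>Automorphisms of the Cayley graph\<close>

lemma cayley_edge_iff:
  assumes "x \<in> carrier W" "y \<in> carrier W"
  shows "{x, y} \<in> cayley_edges W S \<longleftrightarrow> (\<exists>s\<in>S. y = x \<otimes> s)"
proof
  assume "{x, y} \<in> cayley_edges W S"
  then obtain w s where "{x, y} = {w, w \<otimes> s}" "w \<in> carrier W" "s \<in> S"
    by (auto simp: cayley_edges_def)
  then show "\<exists>s\<in>S. y = x \<otimes> s"
    by (intro bexI[of _ s]) (auto simp: doubleton_eq_iff)
qed (use assms in \<open>auto simp: cayley_edges_def\<close>)

abbreviation Aut :: "('a \<Rightarrow> 'a) monoid" where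
  "Aut \<equiv> cayley_aut_group W S"

lemma Aut_iff: "F \<in> carrier Aut \<longleftrightarrow> F \<in> Bij (carrier W) \<and>
    (\<forall>x\<in>carrier W. \<forall>y\<in>carrier W.
      {F x, F y} \<in> cayley_edges W S \<longleftrightarrow> {x, y} \<in> cayley_edges W S)"
  by (simp add: cayley_aut_group_def)

lemma Aut_Bij: "F \<in> carrier Aut \<Longrightarrow> F \<in> Bij (carrier W)"
  by (simp add: Aut_iff)

lemma Aut_closed: "F \<in> carrier Aut \<Longrightarrow> x \<in> carrier W \<Longrightarrow> F x \<in> carrier W"
  using Aut_Bij Bij_imp_funcset by blast

lemma Aut_eq_iff:
  "F \<in> carrier Aut \<Longrightarrow> x \<in> carrier W \<Longrightarrow> y \<in> carrier W \<Longrightarrow> F x = F y \<longleftrightarrow> x = y"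
  using Aut_Bij by (auto simp: Bij_def bij_betw_def inj_on_def)

lemma Aut_mult:
  "F \<in> carrier Aut \<Longrightarrow> G \<in> carrier Aut \<Longrightarrow> F \<otimes>\<^bsub>Aut\<^esub> G = compose (carrier W) F G"
  by (simp add: cayley_aut_group_def BijGroup_def)

lemma Aut_one: "\<one>\<^bsub>Aut\<^esub> = (\<lambda>x\<in>carrier W. x)"
  by (simp add: cayley_aut_group_def BijGroup_def)

text \<open>The restriction makes the inverse extensional, as membership in \<open>Bij\<close>
  demands.\<close>

definition inverse_map :: "('a \<Rightarrow> 'a) \<Rightarrow> 'a \<Rightarrow> 'a" where
  "inverse_map F = (\<lambda>x\<in>carrier W. inv_into (carrier W) F x)"

lemma inverse_map:
  assumes "F \<in> Bij (carrier W)" "x \<in> carrier W"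
  shows "inverse_map F x \<in> carrier W" "F (inverse_map F x) = x" "inverse_map F (F x) = x"
proof -
  have F: "bij_betw F (carrier W) (carrier W)" "F \<in> carrier W \<rightarrow> carrier W"
    using assms Bij_imp_funcset by (auto simp: Bij_def)
  show "inverse_map F x \<in> carrier W"
    using assms Bij_inv_into_mem by (simp add: inverse_map_def)
  show "F (inverse_map F x) = x"
    using assms F bij_betw_inv_into_right by (fastforce simp: inverse_map_def)
  show "inverse_map F (F x) = x"
    using assms F bij_betw_inv_into_left by (fastforce simp: inverse_map_def)
qed

lemma inverse_map_Aut:
  assumes "F \<in> carrier Aut"
  shows "inverse_map F \<in> carrier Aut"
proof -
  note F = Aut_Bij[OF assms]
  have "inverse_map F \<in> Bij (carrier W)"
    unfolding inverse_map_def by (rule restrict_inv_into_Bij[OF F])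
  moreover have "{inverse_map F x, inverse_map F y} \<in> cayley_edges W S \<longleftrightarrow>
      {x, y} \<in> cayley_edges W S" if "x \<in> carrier W" "y \<in> carrier W" for x y
    using assms that inverse_map[OF F] unfolding Aut_iff by metis
  ultimately show ?thesis by (simp add: Aut_iff)
qed

lemma subgroup_Aut: "subgroup (carrier Aut) (BijGroup (carrier W))"
proof (rule group.subgroupI[OF group_BijGroup])
  show "carrier Aut \<subseteq> carrier (BijGroup (carrier W))"
    by (auto simp: BijGroup_def Aut_iff)
  have "(\<lambda>x\<in>carrier W. x) \<in> carrier Aut"
    by (simp add: Aut_iff id_Bij)
  then show "carrier Aut \<noteq> {}" by blast
  fix F assume F: "F \<in> carrier Aut"
  show "inv\<^bsub>BijGroup (carrier W)\<^esub> F \<in> carrier Aut"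
    using inverse_map_Aut[OF F] Aut_Bij[OF F] by (simp add: inv_BijGroup inverse_map_def)
  fix G assume G: "G \<in> carrier Aut"
  have "compose (carrier W) F G \<in> Bij (carrier W)"
    using F G Aut_Bij compose_Bij by blast
  then have "compose (carrier W) F G \<in> carrier Aut"
    using F G Aut_closed[OF G] by (simp add: Aut_iff compose_eq)
  then show "F \<otimes>\<^bsub>BijGroup (carrier W)\<^esub> G \<in> carrier Aut"
    using F G by (simp add: BijGroup_def Aut_Bij)
qed

lemma Aut_eq_BijGroup: "Aut = BijGroup (carrier W) \<lparr>carrier := carrier Aut\<rparr>"
  by (simp add: cayley_aut_group_def)

lemma group_Aut: "group Aut"
  using group.subgroup_imp_group[OF group_BijGroup subgroup_Aut] Aut_eq_BijGroup by simp

lemma inv_Aut: "F \<in> carrier Aut \<Longrightarrow> inv\<^bsub>Aut\<^esub> F = inverse_map F"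
  using group.m_inv_consistent[OF group_BijGroup subgroup_Aut, of F] Aut_eq_BijGroup
    inv_BijGroup[OF Aut_Bij, of F]
  by (simp add: inverse_map_def)

text \<open>The permutation of the labels that \<open>F\<close> induces at the vertex \<open>x\<close>.\<close>

definition loc :: "('a \<Rightarrow> 'a) \<Rightarrow> 'a \<Rightarrow> 'a \<Rightarrow> 'a" where
  "loc F x t = inv (F x) \<otimes> F (x \<otimes> t)"

lemma loc:
  assumes "F \<in> carrier Aut" "x \<in> carrier W" "t \<in> S"
  shows "loc F x t \<in> S" "F (x \<otimes> t) = F x \<otimes> loc F x t"
proof -
  have "{x, x \<otimes> t} \<in> cayley_edges W S"
    using assms by (auto simp: cayley_edges_def)
  then have "{F x, F (x \<otimes> t)} \<in> cayley_edges W S"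
    using assms by (simp add: Aut_iff)
  then obtain r where r: "r \<in> S" "F (x \<otimes> t) = F x \<otimes> r"
    using assms Aut_closed by (auto simp: cayley_edge_iff)
  moreover have "loc F x t = r"
    using r Aut_closed[OF assms(1,2)] by (simp add: loc_def flip: m_assoc)
  ultimately show "loc F x t \<in> S" "F (x \<otimes> t) = F x \<otimes> loc F x t" by auto
qed

lemma loc_inverse_map:
  assumes "F \<in> carrier Aut" "x \<in> carrier W" "t \<in> S"
  shows "loc (inverse_map F) (F x) (loc F x t) = t"
proof -
  have "loc (inverse_map F) (F x) (loc F x t) = inv x \<otimes> (x \<otimes> t)"
    using loc[OF assms] assms inverse_map(3)[OF Aut_Bij[OF assms(1)]]
    by (simp add: loc_def[of "inverse_map F"] flip: loc(2)[OF assms])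
  then show ?thesis using assms by (simp flip: m_assoc)
qed

lemma bij_betw_loc:
  assumes "F \<in> carrier Aut" "x \<in> carrier W"
  shows "bij_betw (loc F x) S S"
proof (rule bij_betw_byWitness[where f' = "loc (inverse_map F) (F x)"])
  note G = inverse_map_Aut[OF assms(1)] and B = Aut_Bij[OF assms(1)]
  show "\<forall>t\<in>S. loc (inverse_map F) (F x) (loc F x t) = t"
    using loc_inverse_map[OF assms] by blast
  show "loc F x ` S \<subseteq> S" using loc(1)[OF assms] by blast
  show "loc (inverse_map F) (F x) ` S \<subseteq> S"
    using loc(1)[OF G Aut_closed[OF assms]] by blast
  show "\<forall>r\<in>S. loc F x (loc (inverse_map F) (F x) r) = r"
  proof
    fix r assume r: "r \<in> S"
    have Fx: "F x \<in> carrier W" using Aut_closed assms by auto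
    have "x \<otimes> loc (inverse_map F) (F x) r = inverse_map F (F x \<otimes> r)"
      using loc(2)[OF G Fx r] inverse_map(3)[OF B assms(2)] by simp
    then have "F (x \<otimes> loc (inverse_map F) (F x) r) = F x \<otimes> r"
      using inverse_map(2)[OF B] Fx r by simp
    then show "loc F x (loc (inverse_map F) (F x) r) = r"
      using Fx r by (simp add: loc_def[of F] flip: m_assoc)
  qed
qed

text \<open>The distance from \<open>x\<close> to \<open>y\<close> in the Cayley graph is the length
  of \<open>x^-1 y\<close>, and \<open>F\<close> carries an edge path to an edge path of the same
  length, relabelled by \<open>loc\<close>.\<close>

lemma len_Aut_le:
  assumes F: "F \<in> carrier Aut" and x: "x \<in> carrier W" and y: "y \<in> carrier W"
  shows "len (inv (F x) \<otimes> F y) \<le> len (inv x \<otimes> y)"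
proof -
  have path: "\<exists>ys. set ys \<subseteq> S \<and> length ys = length xs \<and> F (x \<otimes> lprod xs) = F x \<otimes> lprod ys"
    if "set xs \<subseteq> S" "x \<in> carrier W" for xs x
    using that
  proof (induction xs arbitrary: x)
    case Nil
    then show ?case using Aut_closed[OF F] by auto
  next
    case (Cons a xs)
    then obtain ys where ys: "set ys \<subseteq> S" "length ys = length xs"
        "F (x \<otimes> a \<otimes> lprod xs) = F (x \<otimes> a) \<otimes> lprod ys"
      using Cons.IH[of "x \<otimes> a"] by (metis gen_closed insert_subset list.set(2) m_closed)
    then show ?case
      using Cons.prems loc[OF F, of x a] Aut_closed[OF F, of x]
      by (intro exI[of _ "loc F x a # ys"]) (simp add: m_assoc)
  qed
  obtain xs where xs: "set xs \<subseteq> S" "lprod xs = inv x \<otimes> y" "length xs = len (inv x \<otimes> y)"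
    using ex_reduced[of "inv x \<otimes> y"] x y by auto
  then obtain ys where ys: "set ys \<subseteq> S" "length ys = length xs" "F (x \<otimes> lprod xs) = F x \<otimes> lprod ys"
    using path x by blast
  have "F y = F x \<otimes> lprod ys"
    using ys xs x y by (simp flip: m_assoc)
  then have "inv (F x) \<otimes> F y = lprod ys"
    using ys Aut_closed[OF F x] by (simp flip: m_assoc)
  then show ?thesis
    using len_lprod_le[OF ys(1)] ys xs by simp
qed

lemma len_Aut:
  assumes F: "F \<in> carrier Aut" and x: "x \<in> carrier W" and y: "y \<in> carrier W"
  shows "len (inv (F x) \<otimes> F y) = len (inv x \<otimes> y)"
  using len_Aut_le[OF assms]
    len_Aut_le[OF inverse_map_Aut[OF F] Aut_closed[OF F x] Aut_closed[OF F y]]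
    inverse_map(3)[OF Aut_Bij[OF F]] x y
  by simp

text \<open>Here \<open>z\<close> is the image of the alternating element as seen from
  \<open>F x\<close>. Distances from the neighbours of \<open>x\<close> are preserved, so the left
  descents \<open>s\<close> and \<open>t\<close> become left descents \<open>loc F x s\<close> and
  \<open>loc F x t\<close> of \<open>z\<close>, and \<open>two_descents\<close> applies.\<close>

lemma loc_alt:
  assumes F: "F \<in> carrier Aut" and x: "x \<in> carrier W" and st: "s \<in> S" "t \<in> S" "s \<noteq> t"
    and m: "cox_m W s t = enat n"
  defines "z \<equiv> inv (F x) \<otimes> F (x \<otimes> lprod (alt s t n))"
  shows "cox_m W (loc F x s) (loc F x t) \<le> enat n"
    and "cox_m W (loc F x s) (loc F x t) = enat n \<Longrightarrow> z = lprod (alt (loc F x s) (loc F x t) n)"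
proof -
  define w where "w = lprod (alt s t n)"
  have w: "w \<in> carrier W" using st by (simp add: w_def)
  have Fx: "F x \<in> carrier W" "F (x \<otimes> w) \<in> carrier W" using Aut_closed[OF F] x w by auto
  have z: "z = inv (F x) \<otimes> F (x \<otimes> w)" "z \<in> carrier W"
    using Fx by (simp_all add: z_def w_def)
  have len_z: "len z = n"
    using len_Aut[OF F x, of "x \<otimes> w"] x w alt_descent(1)[OF st(1,2) m]
    by (simp add: z w_def flip: m_assoc)
  have len_r: "len (loc F x r \<otimes> z) = len (r \<otimes> w)" if r: "r \<in> S" for r
  proof -
    have "loc F x r \<otimes> z = inv (F (x \<otimes> r)) \<otimes> F (x \<otimes> w)"
      using loc[OF F x r] Fx by (simp add: z inv_mult_group m_assoc)
    then have "len (loc F x r \<otimes> z) = len (inv (x \<otimes> r) \<otimes> (x \<otimes> w))"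
      using len_Aut[OF F, of "x \<otimes> r" "x \<otimes> w"] x w r by simp
    also have "inv (x \<otimes> r) \<otimes> (x \<otimes> w) = r \<otimes> (inv x \<otimes> x \<otimes> w)"
      using x w r by (simp add: inv_mult_group m_assoc del: l_inv)
    also have "\<dots> = r \<otimes> w" using x w r by simp
    finally show ?thesis .
  qed
  have "loc F x s \<noteq> loc F x t"
    using bij_betw_loc[OF F x] st by (auto simp: bij_betw_def inj_on_def)
  note * = two_descents[OF loc(1)[OF F x st(1)] loc(1)[OF F x st(2)] z(2) _ _ this]
  have "len (s \<otimes> w) < n" "len (t \<otimes> w) < n"
    using alt_descent[OF st(1,2) m] by (simp_all add: w_def)
  then show "cox_m W (loc F x s) (loc F x t) \<le> enat n"
    and "cox_m W (loc F x s) (loc F x t) = enat n \<Longrightarrow> z = lprod (alt (loc F x s) (loc F x t) n)"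
    using * len_r st len_z by auto
qed

text \<open>One inequality is \<open>loc_alt\<close>, trivial for exponent \<infinity>; the other is
  the same statement for the inverse automorphism at \<open>F x\<close>.\<close>

lemma cox_m_loc:
  assumes F: "F \<in> carrier Aut" and x: "x \<in> carrier W" and st: "s \<in> S" "t \<in> S" "s \<noteq> t"
  shows "cox_m W (loc F x s) (loc F x t) = cox_m W s t"
proof (rule antisym)
  have le: "cox_m W (loc G y a) (loc G y b) \<le> cox_m W a b"
    if "G \<in> carrier Aut" "y \<in> carrier W" "a \<in> S" "b \<in> S" "a \<noteq> b" for G y a b
    using loc_alt(1)[OF that] by (cases "cox_m W a b") auto
  show "cox_m W (loc F x s) (loc F x t) \<le> cox_m W s t" using le assms .
  have "loc F x s \<noteq> loc F x t"
    using bij_betw_loc[OF F x] st by (auto simp: bij_betw_def inj_on_def)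
  then show "cox_m W s t \<le> cox_m W (loc F x s) (loc F x t)"
    using le[OF inverse_map_Aut[OF F] Aut_closed[OF F x] loc(1)[OF F x st(1)] loc(1)[OF F x st(2)]]
      loc_inverse_map[OF F x] st by simp
qed

lemma coxeter_diagram_aut_loc:
  "F \<in> carrier Aut \<Longrightarrow> x \<in> carrier W \<Longrightarrow> coxeter_diagram_aut W S (loc F x)"
  by (simp add: coxeter_diagram_aut_def bij_betw_loc cox_m_loc)

text \<open>Crossing the \<open>s\<close>-edge at \<open>x\<close> and returning leads back to
  \<open>F x\<close>, so the two labels are mutually inverse, and generators are
  involutions.\<close>

lemma loc_mult_same:
  assumes F: "F \<in> carrier Aut" and x: "x \<in> carrier W" and s: "s \<in> S"
  shows "loc F (x \<otimes> s) s = loc F x s"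
proof -
  have "loc F x s \<otimes> loc F (x \<otimes> s) s = inv (F x) \<otimes> F x"
    using loc[OF F x s] loc[OF F _ s, of "x \<otimes> s"] x s Aut_closed[OF F x]
    by (simp add: m_assoc)
  then have "loc F x s \<otimes> loc F (x \<otimes> s) s = \<one>"
    using Aut_closed[OF F x] by simp
  then show ?thesis
    using inv_equality[of "loc F x s" "loc F (x \<otimes> s) s"] loc(1)[OF F _ s] x s by simp
qed

text \<open>The path \<open>alt s t n\<close> from \<open>x\<close> and its image are geodesics. The
  label \<open>r\<close> that follows \<open>s'\<close> on the image must be a left descent of the
  remaining alternating element \<open>v\<close>. This forces \<open>r\<close> into the dihedral
  subgroup of \<open>s'\<close> and \<open>t'\<close>, hence to be one of these two letters, and
  injectivity of \<open>F\<close> excludes \<open>s'\<close>.\<close>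

lemma loc_mult_adjacent:
  assumes F: "F \<in> carrier Aut" and x: "x \<in> carrier W" and st: "s \<in> S" "t \<in> S" "s \<noteq> t"
    and m: "cox_m W s t = enat n"
  shows "loc F (x \<otimes> s) t = loc F x t"
proof -
  define s' t' r where "s' = loc F x s" and "t' = loc F x t" and "r = loc F (x \<otimes> s) t"
  define w where "w = lprod (alt s t n)"
  have S: "s' \<in> S" "t' \<in> S" "r \<in> S"
    using loc(1)[OF F] x st by (auto simp: s'_def t'_def r_def)
  have w: "w \<in> carrier W" using st by (simp add: w_def)
  have m': "cox_m W s' t' = enat n"
    using cox_m_loc[OF F x st] m by (simp add: s'_def t'_def)
  \<comment> \<open>Exponent 1 would make \<open>t\<close> the inverse of \<open>s\<close>, that is
    \<open>s\<close> itself. So \<open>n\<close> is at least 2 and two letters can be split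
    off.\<close>
  have "n \<noteq> 1"
  proof
    assume "n = 1"
    then have "s \<otimes> t = \<one>" using cox_m_pow[OF st(1,2) m] st by simp
    then show False using inv_equality[of s t] st by simp
  qed
  then obtain k where n: "n = Suc (Suc k)"
    using cox_m_pow(2)[OF st(1,2) m] by (metis One_nat_def gr0_implies_Suc neq0_conv)
  define v where "v = lprod (alt t' s' (Suc k))"
  have v: "v \<in> carrier W" "len v = Suc k"
    using S m' n len_alt[of t' s' "Suc k"] cox_m_commute[of s' t'] by (simp_all add: v_def)
  have Fx: "F x \<in> carrier W" using Aut_closed[OF F x] .
  have "inv (F x) \<otimes> F (x \<otimes> w) = s' \<otimes> v"
    using loc_alt(2)[OF F x st m] m' by (simp add: s'_def t'_def w_def v_def n)
  then have "F x \<otimes> (inv (F x) \<otimes> F (x \<otimes> w)) = F x \<otimes> (s' \<otimes> v)" by simp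
  then have Fw: "F (x \<otimes> w) = F x \<otimes> s' \<otimes> v"
    using Fx Aut_closed[OF F, of "x \<otimes> w"] x w S v by (simp flip: m_assoc)
  have Fst: "F (x \<otimes> s \<otimes> t) = F x \<otimes> s' \<otimes> r"
    using loc(2)[OF F x st(1)] loc(2)[OF F _ st(2), of "x \<otimes> s"] x st by (simp add: s'_def r_def)
  have "inv (F (x \<otimes> s \<otimes> t)) \<otimes> F (x \<otimes> w) = r \<otimes> v"
  proof -
    have "inv (F (x \<otimes> s \<otimes> t)) \<otimes> F (x \<otimes> w) = r \<otimes> (s' \<otimes> (inv (F x) \<otimes> F x \<otimes> (s' \<otimes> v)))"
      unfolding Fst Fw using Fx S v by (simp add: inv_mult_group m_assoc del: l_inv)
    then show ?thesis using Fx S v by simp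
  qed
  then have "len (r \<otimes> v) = len (inv (x \<otimes> s \<otimes> t) \<otimes> (x \<otimes> w))"
    using len_Aut[OF F, of "x \<otimes> s \<otimes> t" "x \<otimes> w"] x w st by simp
  also have "inv (x \<otimes> s \<otimes> t) \<otimes> (x \<otimes> w) = t \<otimes> (s \<otimes> (inv x \<otimes> x \<otimes> w))"
    using x w st by (simp add: inv_mult_group m_assoc del: l_inv)
  \<comment> \<open>Multiplication by \<open>s\<close> and then \<open>t\<close> strips the first
    two letters of \<open>alt s t n\<close>; what is left has length at most \<open>k\<close>, one
    less than \<open>v\<close>.\<close>
  also have "\<dots> = lprod (alt s t k)"
    using x w st by (simp add: w_def n)
  also have "len \<dots> < len v"
    using len_lprod_le[of "alt s t k"] st v by simp
  finally have "len (r \<otimes> v) < len v" .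
  then obtain bs b cs where split: "alt t' s' (Suc k) = bs @ b # cs" and
      ex: "lprod bs \<otimes> b = r \<otimes> lprod bs"
    using exchange[of "alt t' s' (Suc k)" r] S v by (auto simp: v_def simp del: alt.simps)
  have "set (bs @ b # cs) \<subseteq> {s', t'}" unfolding split[symmetric] by (rule set_alt_subset) auto
  then have bs: "set bs \<subseteq> {s', t'}" "b \<in> {s', t'}" by auto
  then have bs': "set bs \<subseteq> S" "b \<in> S" using S by auto
  \<comment> \<open>Exchange in \<open>v\<close> exhibits \<open>r\<close> as a conjugate of
    \<open>b\<close> by \<open>lprod bs\<close>, which is a word in \<open>s'\<close> and
    \<open>t'\<close> alone.\<close>
  have "lprod (bs @ b # rev bs) = (lprod bs \<otimes> b) \<otimes> inv (lprod bs)"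
    using bs' by (simp add: lprod_rev m_assoc)
  also have "\<dots> = r" unfolding ex using bs' S by (simp add: m_assoc)
  finally have "r \<in> {s', t'}"
    using S bs by (intro lprod_in_gens[of "{s', t'}" "bs @ b # rev bs"]) auto
  moreover have "r \<noteq> s'"
  proof
    assume "r = s'"
    then have "F (x \<otimes> s \<otimes> t) = F x" using Fst Fx S by simp
    then have "x \<otimes> (s \<otimes> t) = x"
      using Aut_eq_iff[OF F, of "x \<otimes> s \<otimes> t" x] x st by (simp add: m_assoc)
    then have "s \<otimes> t = \<one>" using x st by simp
    then show False using inv_equality[of s t] st by simp
  qed
  ultimately show ?thesis by (simp add: r_def t'_def)
qed

subsection \<open>Diagram automorphisms\<close>

text \<open>Distinct generators without an edge are those with exponent \<infinity>, so preserving
  edges in both directions takes care of the infinite exponents.\<close>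

lemma defining_diagram_aut_iff: "defining_diagram_aut W S \<pi> \<longleftrightarrow> coxeter_diagram_aut W S \<pi>"
proof
  assume d: "defining_diagram_aut W S \<pi>"
  then have bij: "bij_betw \<pi> S S" by (simp add: defining_diagram_aut_def)
  have "cox_m W (\<pi> s) (\<pi> t) = cox_m W s t" if "s \<in> S" "t \<in> S" "s \<noteq> t" for s t
  proof (cases "diagram_edge W S s t")
    case True
    then show ?thesis using d that by (simp add: defining_diagram_aut_def)
  next
    case False
    then have "\<not> diagram_edge W S (\<pi> s) (\<pi> t)"
      using d that by (simp add: defining_diagram_aut_def)
    moreover have "\<pi> s \<in> S" "\<pi> t \<in> S" "\<pi> s \<noteq> \<pi> t"
      using bij that by (auto simp: bij_betw_def inj_on_def)
    ultimately show ?thesis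
      using False that by (simp add: diagram_edge_def)
  qed
  with bij show "coxeter_diagram_aut W S \<pi>" by (simp add: coxeter_diagram_aut_def)
next
  assume d: "coxeter_diagram_aut W S \<pi>"
  then have bij: "bij_betw \<pi> S S" by (simp add: coxeter_diagram_aut_def)
  then have "\<pi> s \<in> S" "\<pi> s = \<pi> t \<longleftrightarrow> s = t" if "s \<in> S" "t \<in> S" for s t
    using that by (auto simp: bij_betw_def inj_on_def)
  then show "defining_diagram_aut W S \<pi>"
    using d by (auto simp: defining_diagram_aut_def coxeter_diagram_aut_def diagram_edge_def)
qed

lemma coxeter_diagram_aut_comp:
  assumes "coxeter_diagram_aut W S \<pi>" "coxeter_diagram_aut W S \<rho>"
  shows "coxeter_diagram_aut W S (\<pi> \<circ> \<rho>)"
proof -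
  have "\<rho> s \<in> S" "\<rho> s = \<rho> t \<longleftrightarrow> s = t" if "s \<in> S" "t \<in> S" for s t
    using assms(2) that by (auto simp: coxeter_diagram_aut_def bij_betw_def inj_on_def)
  then show ?thesis
    using assms by (auto simp: coxeter_diagram_aut_def intro: bij_betw_trans)
qed

lemma coxeter_diagram_aut_inv_into:
  assumes "coxeter_diagram_aut W S \<pi>"
  shows "coxeter_diagram_aut W S (inv_into S \<pi>)"
proof -
  let ?i = "inv_into S \<pi>"
  have bij: "bij_betw \<pi> S S" using assms by (simp add: coxeter_diagram_aut_def)
  then have bij': "bij_betw ?i S S" by (rule bij_betw_inv_into)
  have i: "?i s \<in> S" "\<pi> (?i s) = s" if "s \<in> S" for s
    using that bij_betwE[OF bij'] bij_betw_inv_into_right[OF bij] by auto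
  have "cox_m W (?i s) (?i t) = cox_m W s t" if "s \<in> S" "t \<in> S" "s \<noteq> t" for s t
    using assms i[OF that(1)] i[OF that(2)] that(3)
    unfolding coxeter_diagram_aut_def by metis
  then show ?thesis using bij' by (simp add: coxeter_diagram_aut_def)
qed

lemma auto_closed: "f \<in> auto W \<Longrightarrow> x \<in> carrier W \<Longrightarrow> f x \<in> carrier W"
  by (auto simp: auto_def hom_def)

lemma auto_mult:
  "f \<in> auto W \<Longrightarrow> x \<in> carrier W \<Longrightarrow> y \<in> carrier W \<Longrightarrow> f (x \<otimes> y) = f x \<otimes> f y"
  by (auto simp: auto_def hom_def)

lemma auto_one: "f \<in> auto W \<Longrightarrow> f \<one> = \<one>"
  using hom_one[of f W W] is_group by (auto simp: auto_def)

lemma auto_eq_iff: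
  "f \<in> auto W \<Longrightarrow> x \<in> carrier W \<Longrightarrow> y \<in> carrier W \<Longrightarrow> f x = f y \<longleftrightarrow> x = y"
  by (auto simp: auto_def Bij_def bij_betw_def inj_on_def)

lemma diagram_auts_subset_Aut: "diagram_auts W S \<subseteq> carrier Aut"
proof
  fix f assume "f \<in> diagram_auts W S"
  then obtain \<pi> where f: "f \<in> auto W" and \<pi>: "bij_betw \<pi> S S" "\<And>s. s \<in> S \<Longrightarrow> f s = \<pi> s"
    by (auto simp: diagram_auts_def coxeter_diagram_aut_def)
  have "{f x, f y} \<in> cayley_edges W S \<longleftrightarrow> {x, y} \<in> cayley_edges W S"
    if xy: "x \<in> carrier W" "y \<in> carrier W" for x y
  proof -
    have "(\<exists>r\<in>S. f y = f x \<otimes> r) \<longleftrightarrow> (\<exists>s\<in>S. f y = f x \<otimes> f s)"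
      using \<pi> unfolding bij_betw_def by force
    also have "\<dots> \<longleftrightarrow> (\<exists>s\<in>S. y = x \<otimes> s)"
      using f xy auto_eq_iff[OF f, of y] by (auto simp flip: auto_mult)
    finally show ?thesis
      using xy auto_closed[OF f] by (simp add: cayley_edge_iff)
  qed
  then show "f \<in> carrier Aut" using f by (auto simp: Aut_iff auto_def)
qed

lemma subgroup_diagram_auts: "subgroup (diagram_auts W S) Aut"
proof (rule group.subgroupI[OF group_Aut diagram_auts_subset_Aut])
  have "(\<lambda>x\<in>carrier W. x) \<in> auto W"
    using subgroup.one_closed[OF subgroup_auto] by (simp add: BijGroup_def)
  moreover have "coxeter_diagram_aut W S id" by (simp add: coxeter_diagram_aut_def)
  ultimately have "(\<lambda>x\<in>carrier W. x) \<in> diagram_auts W S"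
    by (auto simp: diagram_auts_def intro!: exI[of _ id])
  then show "diagram_auts W S \<noteq> {}" by blast
next
  fix f assume fD: "f \<in> diagram_auts W S"
  then obtain \<pi> where f: "f \<in> auto W" and \<pi>: "coxeter_diagram_aut W S \<pi>" "\<And>s. s \<in> S \<Longrightarrow> f s = \<pi> s"
    by (auto simp: diagram_auts_def)
  have B: "f \<in> Bij (carrier W)" using f by (simp add: auto_def)
  have "inverse_map f \<in> auto W"
    using subgroup.m_inv_closed[OF subgroup_auto f] B by (simp add: inv_BijGroup inverse_map_def)
  moreover have "inverse_map f s = inv_into S \<pi> s" if "s \<in> S" for s
  proof -
    have "bij_betw \<pi> S S" using \<pi> by (simp add: coxeter_diagram_aut_def)
    then have "inv_into S \<pi> s \<in> S" "\<pi> (inv_into S \<pi> s) = s"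
      using that by (auto simp: bij_betw_def inv_into_into f_inv_into_f)
    then show ?thesis
      using \<pi>(2) inverse_map(3)[OF B, of "inv_into S \<pi> s"] by simp
  qed
  ultimately have "inverse_map f \<in> diagram_auts W S"
    using coxeter_diagram_aut_inv_into[OF \<pi>(1)] by (auto simp: diagram_auts_def)
  then show "inv\<^bsub>Aut\<^esub> f \<in> diagram_auts W S"
    using inv_Aut fD diagram_auts_subset_Aut by auto
  fix g assume gD: "g \<in> diagram_auts W S"
  then obtain \<rho> where g: "g \<in> auto W" and \<rho>: "coxeter_diagram_aut W S \<rho>" "\<And>s. s \<in> S \<Longrightarrow> g s = \<rho> s"
    by (auto simp: diagram_auts_def)
  have "compose (carrier W) f g \<in> auto W"
    using subgroup.m_closed[OF subgroup_auto f g] f g by (simp add: BijGroup_def auto_def)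
  moreover have "compose (carrier W) f g s = (\<pi> \<circ> \<rho>) s" if "s \<in> S" for s
  proof -
    have "\<rho> s \<in> S" using \<rho>(1) that by (auto simp: coxeter_diagram_aut_def bij_betw_def)
    then show ?thesis using that \<pi>(2) \<rho>(2) by (simp add: compose_eq)
  qed
  ultimately have "compose (carrier W) f g \<in> diagram_auts W S"
    using coxeter_diagram_aut_comp[OF \<pi>(1) \<rho>(1)]
    unfolding diagram_auts_def by blast
  then show "f \<otimes>\<^bsub>Aut\<^esub> g \<in> diagram_auts W S"
    using fD gD diagram_auts_subset_Aut by (subst Aut_mult) auto
qed

subsection \<open>Left multiplications\<close>

definition left_mult :: "'a \<Rightarrow> 'a \<Rightarrow> 'a" where
  "left_mult w = (\<lambda>x\<in>carrier W. w \<otimes> x)"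

lemma left_mult_auts_eq: "left_mult_auts W = left_mult ` carrier W"
  by (auto simp: left_mult_auts_def left_mult_def)

lemma left_mult_Aut:
  assumes w: "w \<in> carrier W"
  shows "left_mult w \<in> carrier Aut"
proof -
  have "bij_betw (left_mult w) (carrier W) (carrier W)"
    by (rule bij_betw_byWitness[where f' = "left_mult (inv w)"]) (use w in \<open>auto simp: left_mult_def\<close>)
  then have "left_mult w \<in> Bij (carrier W)"
    by (auto simp: Bij_def left_mult_def)
  moreover have "w \<otimes> y = w \<otimes> x \<otimes> s \<longleftrightarrow> y = x \<otimes> s" if "x \<in> carrier W" "y \<in> carrier W" "s \<in> S" for x y s
    using w that by (simp add: m_assoc)
  ultimately show ?thesis
    using w by (simp add: Aut_iff cayley_edge_iff left_mult_def)
qed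

lemma left_mult_mult:
  assumes "v \<in> carrier W" "w \<in> carrier W"
  shows "left_mult v \<otimes>\<^bsub>Aut\<^esub> left_mult w = left_mult (v \<otimes> w)"
  using assms
  by (simp add: Aut_mult left_mult_Aut) (auto simp: compose_def left_mult_def m_assoc)

lemma left_mult_one: "left_mult \<one> = \<one>\<^bsub>Aut\<^esub>"
  by (auto simp: left_mult_def Aut_one)

lemma subgroup_left_mult_auts: "subgroup (left_mult_auts W) Aut"
proof (rule group.subgroupI[OF group_Aut])
  show "left_mult_auts W \<subseteq> carrier Aut" "left_mult_auts W \<noteq> {}"
    using left_mult_Aut by (auto simp: left_mult_auts_eq)
  fix f assume "f \<in> left_mult_auts W"
  then obtain v where v: "v \<in> carrier W" "f = left_mult v" by (auto simp: left_mult_auts_eq)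
  have "inv\<^bsub>Aut\<^esub> f = left_mult (inv v)"
    using v by (intro group.inv_equality[OF group_Aut])
      (auto simp: left_mult_mult left_mult_one left_mult_Aut)
  then show "inv\<^bsub>Aut\<^esub> f \<in> left_mult_auts W" using v by (auto simp: left_mult_auts_eq)
  fix g assume "g \<in> left_mult_auts W"
  then show "f \<otimes>\<^bsub>Aut\<^esub> g \<in> left_mult_auts W"
    using v by (auto simp: left_mult_auts_eq left_mult_mult)
qed

text \<open>Diagram automorphisms fix \<open>\<one>\<close>, whereas \<open>left_mult w\<close>
  sends it to \<open>w\<close>.\<close>

lemma left_mult_auts_Int_diagram_auts: "left_mult_auts W \<inter> diagram_auts W S = {\<one>\<^bsub>Aut\<^esub>}"
proof
  show "{\<one>\<^bsub>Aut\<^esub>} \<subseteq> left_mult_auts W \<inter> diagram_auts W S"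
    using subgroup.one_closed[OF subgroup_left_mult_auts]
      subgroup.one_closed[OF subgroup_diagram_auts] by simp
  show "left_mult_auts W \<inter> diagram_auts W S \<subseteq> {\<one>\<^bsub>Aut\<^esub>}"
  proof
    fix f assume f: "f \<in> left_mult_auts W \<inter> diagram_auts W S"
    then obtain w where w: "w \<in> carrier W" "f = left_mult w" by (auto simp: left_mult_auts_eq)
    have "f \<one> = \<one>" using f auto_one by (auto simp: diagram_auts_def)
    then have "w = \<one>" using w by (simp add: left_mult_def)
    then show "f \<in> {\<one>\<^bsub>Aut\<^esub>}" using w left_mult_one by simp
  qed
qed

subsection \<open>The non-flexible case\<close>

lemma loc_const:
  assumes nf: "\<not> flexible W S" and F: "F \<in> carrier Aut" and x: "x \<in> carrier W" and t: "t \<in> S"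
  shows "loc F x t = loc F \<one> t"
  using x
proof (induction rule: carrier_induct)
  case (mult x s)
  let ?i = "inv_into S (loc F x)"
  \<comment> \<open>\<open>\<phi>\<close> compares the label permutations at the two ends of an
    \<open>s\<close>-edge. It fixes \<open>s\<close> and its neighbours, so non-flexibility makes it
    the identity on \<open>S\<close>.\<close>
  define \<phi> where "\<phi> = ?i \<circ> loc F (x \<otimes> s)"
  have xs: "x \<otimes> s \<in> carrier W" using mult by simp
  have bij: "bij_betw (loc F x) S S" using bij_betw_loc[OF F mult(1)] .
  have \<phi>: "defining_diagram_aut W S \<phi>"
    unfolding defining_diagram_aut_iff \<phi>_def
    by (intro coxeter_diagram_aut_comp coxeter_diagram_aut_inv_into coxeter_diagram_aut_loc F xs mult)
  have fix_\<phi>: "\<phi> r = r" if "r \<in> S" "loc F (x \<otimes> s) r = loc F x r" for r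
    using that bij by (simp add: \<phi>_def bij_betw_def)
  have "\<phi> r = r" if r: "diagram_edge W S s r" for r
  proof -
    obtain n where "cox_m W s r = enat n" using r by (cases "cox_m W s r") (auto simp: diagram_edge_def)
    then show ?thesis
      using r loc_mult_adjacent[OF F mult(1,2), of r] by (intro fix_\<phi>) (auto simp: diagram_edge_def)
  qed
  moreover have "\<phi> s = s"
    using fix_\<phi> loc_mult_same[OF F mult(1,2)] mult(2) by blast
  ultimately have "\<phi> t = t"
    using nf \<phi> mult(2) t unfolding flexible_def by blast
  moreover have "loc F x (\<phi> t) = loc F (x \<otimes> s) t"
    using bij_betw_inv_into_right[OF bij loc(1)[OF F xs t]] by (simp add: \<phi>_def)
  ultimately show ?case using mult by simp
qed simp

text \<open>Translating \<open>F\<close> so that it fixes \<open>\<one>\<close> gives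
  \<open>d\<close>. By \<open>loc_const\<close> each letter \<open>t\<close> is relabelled in the
  same way at every vertex, so induction on the second factor shows that \<open>d\<close> is
  multiplicative.\<close>

lemma Aut_decomp:
  assumes nf: "\<not> flexible W S" and F: "F \<in> carrier Aut"
  obtains u d where "u \<in> carrier W" "d \<in> diagram_auts W S" "F = left_mult u \<otimes>\<^bsub>Aut\<^esub> d"
proof -
  define u where "u = F \<one>"
  have u: "u \<in> carrier W" using Aut_closed[OF F] by (simp add: u_def)
  define d where "d = left_mult (inv u) \<otimes>\<^bsub>Aut\<^esub> F"
  interpret A: group Aut by (rule group_Aut)
  have dA: "d \<in> carrier Aut" unfolding d_def using u F left_mult_Aut by simp
  have d_eq: "d x = inv u \<otimes> F x" if "x \<in> carrier W" for x
    using that u F Aut_closed[OF F that]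
    by (simp add: d_def Aut_mult left_mult_Aut compose_eq) (simp add: left_mult_def)
  have d_gen: "d (x \<otimes> t) = d x \<otimes> loc F \<one> t" if "x \<in> carrier W" "t \<in> S" for x t
    using that u loc[OF F that] Aut_closed[OF F that(1)] loc_const[OF nf F that]
    by (simp add: d_eq m_assoc)
  have "d (x \<otimes> y) = d x \<otimes> d y" if x: "x \<in> carrier W" and "y \<in> carrier W" for x y
    using that(2)
  proof (induction rule: carrier_induct)
    case one
    then show ?case using x u Aut_closed[OF dA x] by (simp add: d_eq[of \<one>] flip: u_def)
  next
    case (mult y s)
    have "d (x \<otimes> (y \<otimes> s)) = d (x \<otimes> y) \<otimes> loc F \<one> s"
      using mult x d_gen[of "x \<otimes> y" s] by (simp add: m_assoc)
    also have "\<dots> = d x \<otimes> d (y \<otimes> s)"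
      using mult x d_gen[of y s] Aut_closed[OF dA] loc(1)[OF F one_closed mult(2)]
      by (simp add: m_assoc)
    finally show ?case .
  qed
  then have "d \<in> auto W"
    using Aut_closed[OF dA] Aut_Bij[OF dA] by (auto simp: auto_def hom_def)
  moreover have "d s = loc F \<one> s" if "s \<in> S" for s
    using that by (simp add: d_eq loc_def u_def)
  ultimately have "d \<in> diagram_auts W S"
    using coxeter_diagram_aut_loc[OF F one_closed] by (auto simp: diagram_auts_def)
  moreover have "left_mult u \<otimes>\<^bsub>Aut\<^esub> d = F"
    unfolding d_def using u F left_mult_Aut
    by (simp add: left_mult_mult left_mult_one flip: A.m_assoc)
  ultimately show ?thesis using that u by blast
qed

text \<open>This commutation rule says that \<open>d\<close> conjugates \<open>left_mult w\<close>
  to \<open>left_mult (d w)\<close>; it is what makes the left multiplications normal.\<close>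

lemma diagram_aut_left_mult:
  assumes d: "d \<in> diagram_auts W S" and w: "w \<in> carrier W"
  shows "d \<otimes>\<^bsub>Aut\<^esub> left_mult w = left_mult (d w) \<otimes>\<^bsub>Aut\<^esub> d"
proof -
  have da: "d \<in> auto W" "d \<in> carrier Aut"
    using d diagram_auts_subset_Aut by (auto simp: diagram_auts_def)
  then have "compose (carrier W) d (left_mult w) = compose (carrier W) (left_mult (d w)) d"
    using w auto_closed[OF da(1)]
    by (auto simp: compose_def left_mult_def auto_mult fun_eq_iff)
  then show ?thesis
    using da w auto_closed[OF da(1) w] by (simp add: Aut_mult left_mult_Aut)
qed

lemma not_flexible_imp_semidirect:
  assumes nf: "\<not> flexible W S"
  shows "internal_semidirect_product Aut (left_mult_auts W) (diagram_auts W S)"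
proof -
  interpret A: group Aut by (rule group_Aut)
  have "F \<otimes>\<^bsub>Aut\<^esub> h \<otimes>\<^bsub>Aut\<^esub> inv\<^bsub>Aut\<^esub> F \<in> left_mult_auts W"
    if F: "F \<in> carrier Aut" and h: "h \<in> left_mult_auts W" for F h
  proof -
    obtain w where w: "w \<in> carrier W" "h = left_mult w" using h by (auto simp: left_mult_auts_eq)
    obtain u d where ud: "u \<in> carrier W" "d \<in> diagram_auts W S" "F = left_mult u \<otimes>\<^bsub>Aut\<^esub> d"
      using Aut_decomp[OF nf F] .
    have d: "d \<in> carrier Aut" "d w \<in> carrier W"
      using ud(2) diagram_auts_subset_Aut Aut_closed w by blast+
    \<comment> \<open>Conjugation by \<open>F\<close>, which is \<open>left_mult u\<close> after
      \<open>d\<close>, first turns \<open>w\<close> into \<open>d w\<close> and then conjugates by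
      \<open>u\<close>.\<close>
    define v where "v = u \<otimes> d w \<otimes> inv u"
    have v: "v \<in> carrier W" using ud d by (simp add: v_def)
    have "F \<otimes>\<^bsub>Aut\<^esub> h = left_mult u \<otimes>\<^bsub>Aut\<^esub> left_mult (d w) \<otimes>\<^bsub>Aut\<^esub> d"
      using ud d w left_mult_Aut diagram_aut_left_mult[OF ud(2) w(1)] by (simp add: A.m_assoc)
    also have "\<dots> = left_mult (v \<otimes> u) \<otimes>\<^bsub>Aut\<^esub> d"
      using ud d by (simp add: left_mult_mult v_def m_assoc)
    also have "\<dots> = left_mult v \<otimes>\<^bsub>Aut\<^esub> F"
      using ud d v left_mult_Aut by (simp add: A.m_assoc flip: left_mult_mult)
    finally have "F \<otimes>\<^bsub>Aut\<^esub> h \<otimes>\<^bsub>Aut\<^esub> inv\<^bsub>Aut\<^esub> F = left_mult v"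
      using F v left_mult_Aut by (simp add: A.m_assoc)
    then show ?thesis using v by (simp add: left_mult_auts_eq)
  qed
  then have "left_mult_auts W \<lhd> Aut"
    using A.normal_inv_iff subgroup_left_mult_auts by blast
  moreover have "left_mult_auts W <#>\<^bsub>Aut\<^esub> diagram_auts W S = carrier Aut"
  proof
    show "left_mult_auts W <#>\<^bsub>Aut\<^esub> diagram_auts W S \<subseteq> carrier Aut"
      using A.set_mult_closed subgroup.subset[OF subgroup_left_mult_auts] diagram_auts_subset_Aut by blast
    show "carrier Aut \<subseteq> left_mult_auts W <#>\<^bsub>Aut\<^esub> diagram_auts W S"
    proof
      fix F assume F: "F \<in> carrier Aut"
      obtain u d where "u \<in> carrier W" "d \<in> diagram_auts W S" "F = left_mult u \<otimes>\<^bsub>Aut\<^esub> d"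
        using Aut_decomp[OF nf F] .
      then show "F \<in> left_mult_auts W <#>\<^bsub>Aut\<^esub> diagram_auts W S"
        by (auto simp: set_mult_def left_mult_auts_eq)
    qed
  qed
  ultimately show ?thesis
    using subgroup_diagram_auts left_mult_auts_Int_diagram_auts
    by (simp add: internal_semidirect_product_def)
qed

subsection \<open>The flexible case\<close>

text \<open>Both the permutation and its inverse preserve the relations, so each extends to an
  endomorphism. The two composites fix \<open>S\<close> pointwise and hence are the
  identity.\<close>

lemma auto_extends_diagram_aut:
  assumes \<pi>: "coxeter_diagram_aut W S \<pi>"
  obtains f where "f \<in> diagram_auts W S" "\<And>s. s \<in> S \<Longrightarrow> f s = \<pi> s"
proof -
  have ext: "\<exists>f. f \<in> hom W W \<and> (\<forall>s\<in>S. f s = \<rho> s)" if \<rho>: "coxeter_diagram_aut W S \<rho>" for \<rho>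
  proof -
    have \<rho>S: "\<rho> s \<in> S" if "s \<in> S" for s
      using \<rho> that by (auto simp: coxeter_diagram_aut_def bij_betw_def)
    then have map_S: "set (map \<rho> xs) \<subseteq> S" if "set xs \<subseteq> S" for xs using that by auto
    \<comment> \<open>Each letter acts by right multiplication with its image under
      \<open>\<rho>\<close>; this puts \<open>fold_action_cong\<close> to use.\<close>
    have fold_eq: "fold (\<lambda>s x. x \<otimes> \<rho> s) xs x = x \<otimes> lprod (map \<rho> xs)"
      if "set xs \<subseteq> S" "x \<in> carrier W" for xs x
      using that \<rho>S map_S by (induction xs arbitrary: x) (simp_all add: m_assoc)
    have cong: "lprod (map \<rho> xs) = lprod (map \<rho> ys)"
      if xs: "set xs \<subseteq> S" and ys: "set ys \<subseteq> S" and eq: "lprod xs = lprod ys" for xs ys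
    proof -
      have "fold (\<lambda>s x. x \<otimes> \<rho> s) xs \<one> = fold (\<lambda>s x. x \<otimes> \<rho> s) ys \<one>"
      proof (rule fold_action_cong[where Y = "carrier W"])
        fix s t n x assume *: "s \<in> S" "t \<in> S" "s \<noteq> t" "cox_m W s t = enat n" "x \<in> carrier W"
        have "map \<rho> (concat (replicate n [s, t])) = alt (\<rho> s) (\<rho> t) (2 * n)"
          by (simp add: map_concat flip: concat_replicate_eq_alt)
        moreover have "cox_m W (\<rho> s) (\<rho> t) = enat n"
          using \<rho> * by (simp add: coxeter_diagram_aut_def)
        ultimately have "lprod (map \<rho> (concat (replicate n [s, t]))) = \<one>"
          using * \<rho>S by (simp add: lprod_alt_double cox_m_pow)
        then show "fold (\<lambda>s x. x \<otimes> \<rho> s) (concat (replicate n [s, t])) x = x"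
          using * fold_eq[of "concat (replicate n [s, t])" x] by simp
      qed (use xs ys eq \<rho>S in auto)
      then show ?thesis using xs ys map_S by (simp add: fold_eq)
    qed
    \<comment> \<open>The choice of the word is harmless by \<open>cong\<close>.\<close>
    define f where "f x = lprod (map \<rho> (SOME xs. set xs \<subseteq> S \<and> lprod xs = x))" for x
    have f: "f (lprod xs) = lprod (map \<rho> xs)" if "set xs \<subseteq> S" for xs
    proof -
      let ?ys = "SOME ys. set ys \<subseteq> S \<and> lprod ys = lprod xs"
      have "set ?ys \<subseteq> S \<and> lprod ?ys = lprod xs"
        by (rule someI[of _ xs]) (use that in simp)
      then show ?thesis unfolding f_def using cong that by blast
    qed
    have "f \<in> hom W W"
    proof (rule homI)
      fix x assume x: "x \<in> carrier W"
      obtain xs where xs: "set xs \<subseteq> S" "lprod xs = x" using ex_lprod[OF x] .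
      then show "f x \<in> carrier W" using f map_S by (metis lprod_closed)
      fix y assume y: "y \<in> carrier W"
      obtain ys where ys: "set ys \<subseteq> S" "lprod ys = y" using ex_lprod[OF y] .
      have "f (x \<otimes> y) = f (lprod (xs @ ys))" using xs ys by simp
      also have "\<dots> = f x \<otimes> f y"
        using xs ys f[of "xs @ ys"] f[of xs] f[of ys] map_S by simp
      finally show "f (x \<otimes> y) = f x \<otimes> f y" .
    qed
    moreover have "f s = \<rho> s" if "s \<in> S" for s
      using f[of "[s]"] that \<rho>S by simp
    ultimately show ?thesis by blast
  qed
  have unique: "h x = x" if "h \<in> hom W W" "\<And>s. s \<in> S \<Longrightarrow> h s = s" "x \<in> carrier W" for h x
    using that(3)
  proof (induction rule: carrier_induct)
    case one
    then show ?case using hom_one[OF that(1)] is_group by simp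
  next
    case (mult x s)
    then show ?case using that(2) hom_mult[OF that(1)] by simp
  qed
  obtain f where f: "f \<in> hom W W" "\<And>s. s \<in> S \<Longrightarrow> f s = \<pi> s" using ext[OF \<pi>] by blast
  obtain g where g: "g \<in> hom W W" "\<And>s. s \<in> S \<Longrightarrow> g s = inv_into S \<pi> s"
    using ext[OF coxeter_diagram_aut_inv_into[OF \<pi>]] by blast
  have bij: "bij_betw \<pi> S S" using \<pi> by (simp add: coxeter_diagram_aut_def)
  have bij': "bij_betw (inv_into S \<pi>) S S" using bij by (rule bij_betw_inv_into)
  have gf: "g (f x) = x" if "x \<in> carrier W" for x
    using unique[of "g \<circ> f" x] that Group.hom_compose[OF f(1) g(1)] f g
      bij_betwE[OF bij] bij_betw_inv_into_left[OF bij] by simp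
  have fg: "f (g x) = x" if "x \<in> carrier W" for x
    using unique[of "f \<circ> g" x] that Group.hom_compose[OF g(1) f(1)] f g
      bij_betwE[OF bij'] bij_betw_inv_into_right[OF bij] by simp
  define F where "F = restrict f (carrier W)"
  have "bij_betw f (carrier W) (carrier W)"
    by (rule bij_betw_byWitness[where f' = g]) (use gf fg hom_in_carrier[OF f(1)] hom_in_carrier[OF g(1)] in auto)
  then have "F \<in> Bij (carrier W)"
    by (simp add: Bij_def F_def bij_betw_restrict_eq)
  moreover have "F \<in> hom W W"
    using f(1) by (simp add: F_def hom_def Pi_def)
  ultimately have "F \<in> auto W" by (simp add: auto_def)
  moreover have "F s = \<pi> s" if "s \<in> S" for s using f(2) that by (simp add: F_def)
  ultimately show ?thesis using that \<pi> by (auto simp: diagram_auts_def)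
qed

text \<open>The \<open>s\<close>-edges with exactly one end in \<open>H\<close> form a cut. On a relator involving \<open>s\<close> the cochain
  \<open>f\<close> below is the coboundary of the indicator function of \<open>H\<close>, and on all other relators it
  vanishes; hence it is a cocycle and integrates to the indicator function \<open>c\<close> of a half-space.\<close>

lemma halfspace:
  assumes s: "s \<in> S" and H_gen: "\<And>x t. x \<in> carrier W \<Longrightarrow> diagram_edge W S s t \<Longrightarrow> x \<otimes> t \<in> H \<longleftrightarrow> x \<in> H"
  obtains c where "\<not> c \<one>" "\<And>x. x \<in> carrier W \<Longrightarrow> c (x \<otimes> s) = (c x \<noteq> ((x \<in> H) \<noteq> (x \<otimes> s \<in> H)))"
    "\<And>x t. x \<in> carrier W \<Longrightarrow> t \<in> S \<Longrightarrow> t \<noteq> s \<Longrightarrow> c (x \<otimes> t) = c x"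
proof -
  define f where "f = (\<lambda>x t. t = s \<and> (x \<in> H) \<noteq> (x \<otimes> s \<in> H))"
  have cong: "path_sum f xs \<one> = path_sum f ys \<one>"
    if "set xs \<subseteq> S" "set ys \<subseteq> S" "lprod xs = lprod ys" for xs ys
  proof (rule path_sum_cong)
    fix a b n x
    assume *: "a \<in> S" "b \<in> S" "a \<noteq> b" "cox_m W a b = enat n" "x \<in> carrier W"
    show "\<not> path_sum f (alt a b (2 * n)) x"
    proof (cases "s = a \<or> s = b")
      case False
      have "\<not> path_sum f xs x" if "s \<notin> set xs" for xs x
        using that by (induction xs arbitrary: x) (auto simp: f_def)
      moreover have "set (alt a b (2 * n)) \<subseteq> {a, b}" by (rule set_alt_subset) auto
      ultimately show ?thesis using False by blast
    next
      case True
      then have "diagram_edge W S s (if s = a then b else a)"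
        using * cox_m_commute[of a b] by (auto simp: diagram_edge_def)
      \<comment> \<open>The letter other than \<open>s\<close> is joined to \<open>s\<close>, so by
        \<open>H_gen\<close> membership in \<open>H\<close> does not change along it, in accordance
        with the value of \<open>f\<close> there. The sum therefore telescopes, and it vanishes on
        the closed relator path.\<close>
      then have f_eq: "f x r \<longleftrightarrow> (x \<in> H) \<noteq> (x \<otimes> r \<in> H)" if "x \<in> carrier W" "r \<in> {a, b}" for x r
        using that True H_gen by (auto simp: f_def split: if_splits)
      have "path_sum f xs x \<longleftrightarrow> (x \<in> H) \<noteq> (x \<otimes> lprod xs \<in> H)"
        if "set xs \<subseteq> {a, b}" "x \<in> carrier W" for xs x
        using that
      proof (induction xs arbitrary: x)
        case (Cons r xs)
        have "set xs \<subseteq> S" "r \<in> S" using Cons.prems * by auto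
        then show ?case using Cons f_eq[of x r] by (auto simp: m_assoc)
      qed simp
      moreover have "set (alt a b (2 * n)) \<subseteq> {a, b}" by (rule set_alt_subset) auto
      moreover have "lprod (alt a b (2 * n)) = \<one>"
        using * by (simp add: lprod_alt_double cox_m_pow)
      ultimately show ?thesis using * by simp
    qed
  qed (use that s in \<open>auto simp: f_def\<close>)
  define c where "c x = path_sum f (SOME xs. set xs \<subseteq> S \<and> lprod xs = x) \<one>" for x
  have c: "c (lprod xs) = path_sum f xs \<one>" if "set xs \<subseteq> S" for xs
  proof -
    let ?ys = "SOME ys. set ys \<subseteq> S \<and> lprod ys = lprod xs"
    have "set ?ys \<subseteq> S \<and> lprod ?ys = lprod xs"
      by (rule someI[of _ xs]) (use that in simp)
    then show ?thesis unfolding c_def using cong that by blast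
  qed
  have step: "c (x \<otimes> t) = (c x \<noteq> f x t)" if x: "x \<in> carrier W" and t: "t \<in> S" for x t
  proof -
    obtain xs where xs: "set xs \<subseteq> S" "lprod xs = x" using ex_lprod[OF x] .
    have "c (x \<otimes> t) = path_sum f (xs @ [t]) \<one>"
      using c[of "xs @ [t]"] xs t by simp
    also have "\<dots> = (c x \<noteq> f x t)"
      using c[of xs] xs t x by (simp add: path_sum_append)
    finally show ?thesis .
  qed
  show ?thesis
  proof (rule that[of c])
    show "\<not> c \<one>" using c[of "[]"] by simp
  qed (use step s in \<open>auto simp: f_def\<close>)
qed

lemma flexible_imp_not_semidirect:
  assumes "flexible W S"
  shows "left_mult_auts W <#>\<^bsub>Aut\<^esub> diagram_auts W S \<noteq> carrier Aut"
proof
  assume prod: "left_mult_auts W <#>\<^bsub>Aut\<^esub> diagram_auts W S = carrier Aut"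
  obtain s \<phi> u where s: "s \<in> S" and \<phi>: "coxeter_diagram_aut W S \<phi>" and u: "u \<in> S" "\<phi> u \<noteq> u"
    and fixed: "\<phi> s = s" "\<And>t. diagram_edge W S s t \<Longrightarrow> \<phi> t = t"
    using assms unfolding flexible_def defining_diagram_aut_iff by (auto simp: diagram_edge_def)
  obtain h where h: "h \<in> diagram_auts W S" "\<And>t. t \<in> S \<Longrightarrow> h t = \<phi> t"
    using auto_extends_diagram_aut[OF \<phi>] by blast
  have ha: "h \<in> auto W" and hA: "h \<in> carrier Aut"
    using h(1) diagram_auts_subset_Aut by (auto simp: diagram_auts_def)
  have h_closed: "h x \<in> carrier W" if "x \<in> carrier W" for x using auto_closed[OF ha that] .
  define L where "L = {t. diagram_edge W S s t}"
  have L: "L \<subseteq> S" "s \<notin> L" by (auto simp: L_def diagram_edge_def)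
  \<comment> \<open>\<open>H\<close> is the subgroup generated by the neighbours of
    \<open>s\<close>; words without inverses suffice for involutions. That \<open>s\<close> lies
    outside comes from \<open>lprod_in_gens\<close>.\<close>
  define H where "H = lprod ` {xs. set xs \<subseteq> L}"
  have H: "H \<subseteq> carrier W" "\<one> \<in> H" "s \<notin> H"
    using L lprod_in_gens[OF L(1) _ s] by (auto simp: H_def image_iff intro!: exI[of _ "[]"])
  have H_mult: "x \<otimes> t \<in> H" if "x \<in> H" "t \<in> L" for x t
  proof -
    obtain xs where xs: "set xs \<subseteq> L" "x = lprod xs" using \<open>x \<in> H\<close> by (auto simp: H_def)
    have "x \<otimes> t = lprod (xs @ [t])"
      using xs that(2) L lprod_append[of xs "[t]"] by (simp add: subset_iff)
    then show ?thesis using xs that by (auto simp: H_def intro!: image_eqI[of _ _ "xs @ [t]"])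
  qed
  have H_gen: "x \<otimes> t \<in> H \<longleftrightarrow> x \<in> H" if "x \<in> carrier W" "diagram_edge W S s t" for x t
    using H_mult[of x t] H_mult[of "x \<otimes> t" t] that by (auto simp: L_def diagram_edge_def)
  obtain c where c1: "\<not> c \<one>"
    and cs: "\<And>x. x \<in> carrier W \<Longrightarrow> c (x \<otimes> s) = (c x \<noteq> ((x \<in> H) \<noteq> (x \<otimes> s \<in> H)))"
    and ct: "\<And>x t. x \<in> carrier W \<Longrightarrow> t \<in> S \<Longrightarrow> t \<noteq> s \<Longrightarrow> c (x \<otimes> t) = c x"
    using halfspace[OF s H_gen] by blast
  have h_fix: "h x = x" if "x \<in> H" for x
  proof -
    have "set xs \<subseteq> L \<Longrightarrow> h (lprod xs) = lprod xs" for xs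
    proof (induction xs)
      case Nil
      then show ?case using auto_one[OF ha] by simp
    next
      case (Cons t xs)
      then have "t \<in> S" "set xs \<subseteq> S" "\<phi> t = t" using L fixed(2) by (auto simp: L_def)
      then show ?case using Cons by (simp add: auto_mult[OF ha] h(2))
    qed
    then show ?thesis using that by (auto simp: H_def)
  qed
  \<comment> \<open>If \<open>h x\<close> lies in \<open>H\<close>, it is itself fixed by
    \<open>h\<close>, and injectivity gives \<open>h x = x\<close>.\<close>
  have hH: "h x \<in> H \<longleftrightarrow> x \<in> H" if "x \<in> carrier W" for x
    using h_fix auto_eq_iff[OF ha h_closed[OF that] that] by metis
  \<comment> \<open>Words over \<open>L\<close> avoid \<open>s\<close>, and only
    \<open>s\<close>-edges can change \<open>c\<close>; so all of \<open>H\<close> is on the side of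
    \<open>\<one>\<close>.\<close>
  have cH: "\<not> c x" if "x \<in> H" for x
  proof -
    have "set xs \<subseteq> L \<Longrightarrow> \<not> c (lprod xs)" for xs
    proof (induction xs rule: rev_induct)
      case (snoc t xs)
      then have "t \<in> S" "t \<noteq> s" "set xs \<subseteq> S" using L by auto
      then show ?case using snoc ct[of "lprod xs" t] by simp
    qed (use c1 in simp)
    then show ?thesis using that by (auto simp: H_def)
  qed
  \<comment> \<open>The cut is invariant under \<open>h\<close>, which maps \<open>s\<close>-edges
    to \<open>s\<close>-edges and preserves membership in \<open>H\<close>; as \<open>h\<close>
    fixes \<open>\<one>\<close>, it preserves each side.\<close>
  have ch: "c (h x) = c x" if "x \<in> carrier W" for x
    using that
  proof (induction rule: carrier_induct)
    case one
    then show ?case using auto_one[OF ha] by simp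
  next
    case (mult x t)
    have h_mult: "h (x \<otimes> t) = h x \<otimes> \<phi> t" using mult auto_mult[OF ha] h(2) by simp
    show ?case
    proof (cases "t = s")
      case True
      then show ?thesis
        using h_mult mult fixed(1) cs[of x] cs[of "h x"] hH[of x] hH[of "x \<otimes> s"] h_closed by simp
    next
      case False
      have "\<phi> t \<in> S" "\<phi> t \<noteq> s"
        using \<phi> mult False s fixed(1) by (auto simp: coxeter_diagram_aut_def bij_betw_def inj_on_def)
      then show ?thesis
        using h_mult mult False ct[of x t] ct[of "h x" "\<phi> t"] h_closed by simp
    qed
  qed
  \<comment> \<open>An edge between the sides is an \<open>s\<close>-edge with exactly one end in
    \<open>H\<close>, and by \<open>cH\<close> that end is on the side of
    \<open>\<one>\<close>.\<close>
  have cross: "y \<in> H" if xy: "x \<in> carrier W" "y \<in> carrier W" "{x, y} \<in> cayley_edges W S" "c x" "\<not> c y" for x y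
  proof -
    obtain t where t: "t \<in> S" "y = x \<otimes> t" using xy by (auto simp: cayley_edge_iff)
    then have "t = s" using ct xy by auto
    then show ?thesis using cs[OF xy(1)] cH[of x] xy t by auto
  qed
  define F where "F = (\<lambda>x\<in>carrier W. if c x then x else h x)"
  have "F \<in> carrier Aut"
  proof -
    note hB = Aut_Bij[OF hA]
    have ch': "c (inverse_map h x) = c x" if "x \<in> carrier W" for x
      using ch[of "inverse_map h x"] inverse_map[OF hB that] by simp
    have "bij_betw F (carrier W) (carrier W)"
      by (rule bij_betw_byWitness[where f' = "\<lambda>x. if c x then x else inverse_map h x"])
        (use ch ch' h_closed inverse_map[OF hB] in \<open>auto simp: F_def\<close>)
    then have "F \<in> Bij (carrier W)" by (simp add: Bij_def F_def)
    moreover have "{F x, F y} \<in> cayley_edges W S \<longleftrightarrow> {x, y} \<in> cayley_edges W S"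
      if x: "x \<in> carrier W" and y: "y \<in> carrier W" for x y
    proof -
      \<comment> \<open>In either case \<open>cross\<close> puts the end on the side of
        \<open>\<one>\<close> into \<open>H\<close>, where \<open>h\<close> is the identity, so the
        two halves of \<open>F\<close> agree with the edges across the cut.\<close>
      have mixed: "{x, h y} \<in> cayley_edges W S \<longleftrightarrow> {x, y} \<in> cayley_edges W S"
        if "x \<in> carrier W" "y \<in> carrier W" "c x" "\<not> c y" for x y
      proof -
        have "h y = y" if "{x, y} \<in> cayley_edges W S \<or> {x, h y} \<in> cayley_edges W S"
          using that cross[of x y] cross[of x "h y"] \<open>x \<in> carrier W\<close> \<open>y \<in> carrier W\<close> \<open>c x\<close> \<open>\<not> c y\<close>
            h_closed[of y] ch[of y] hH[of y] h_fix[of y] by blast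
        then show ?thesis by auto
      qed
      consider "c x = c y" | "c x" "\<not> c y" | "\<not> c x" "c y" by blast
      then show ?thesis
      proof cases
        case 1
        then show ?thesis using x y hA by (auto simp: F_def Aut_iff)
      next
        case 2
        then show ?thesis using x y mixed[of x y] by (simp add: F_def)
      next
        case 3
        then show ?thesis using x y mixed[of y x] by (simp add: F_def insert_commute)
      qed
    qed
    ultimately show ?thesis by (simp add: Aut_iff)
  qed
  then obtain w d where w: "w \<in> carrier W" and d: "d \<in> diagram_auts W S"
    and F_eq: "F = left_mult w \<otimes>\<^bsub>Aut\<^esub> d"
    unfolding prod[symmetric] by (auto simp: set_mult_def left_mult_auts_eq)
  have da: "d \<in> auto W" "d \<in> carrier Aut"
    using d diagram_auts_subset_Aut by (auto simp: diagram_auts_def)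
  have F_d: "F x = w \<otimes> d x" if "x \<in> carrier W" for x
    using that w da Aut_closed[OF da(2) that]
    by (simp add: F_eq Aut_mult left_mult_Aut compose_eq) (simp add: left_mult_def)
  have "F \<one> = \<one>" using c1 auto_one[OF ha] by (simp add: F_def)
  then have "w = \<one>" using F_d[of \<one>] auto_one[OF da(1)] w by simp
  then have F_d: "F x = d x" if "x \<in> carrier W" for x
    using F_d that Aut_closed[OF da(2) that] by simp
  have us: "u \<noteq> s" using u fixed by auto
  \<comment> \<open>The edge from \<open>\<one>\<close> to \<open>s\<close> belongs to the
    cut.\<close>
  have c_s: "c s" using cs[of \<one>] c1 H s by simp
  have "c (s \<otimes> u)" using c_s ct[of s u] s u us by simp
  moreover have "\<not> c u" using c1 ct[of \<one> u] u us by simp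
  \<comment> \<open>\<open>F\<close> fixes \<open>s\<close> and \<open>s \<otimes> u\<close> but
    moves \<open>u\<close> to \<open>\<phi> u\<close>. Since \<open>F\<close> agrees with the
    homomorphism \<open>d\<close>, this contradicts \<open>\<phi> u \<noteq> u\<close>.\<close>
  ultimately have "s \<otimes> u = s \<otimes> \<phi> u"
    using F_d[of "s \<otimes> u"] F_d[of s] F_d[of u] auto_mult[OF da(1), of s u] s u c_s h(2)
    by (simp add: F_def)
  moreover have "\<phi> u \<in> S" using \<phi> u by (auto simp: coxeter_diagram_aut_def bij_betw_def)
  ultimately show False using s u by simp
qed

end

theorem corollary2:
  fixes W :: "('a, 'b) monoid_scheme" and S :: "'a set"
  assumes "coxeter_system W S" and "finite S"
  shows "\<not> flexible W S \<longleftrightarrow>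
    internal_semidirect_product (cayley_aut_group W S) (left_mult_auts W) (diagram_auts W S)"
proof -
  interpret coxeter W S
    using assms(1) by (simp add: coxeter_system_def coxeter_def coxeter_axioms_def)
  show ?thesis
    using not_flexible_imp_semidirect flexible_imp_not_semidirect
    by (auto simp: internal_semidirect_product_def)
qed

end
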